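(* Let $\mathcal{Z}=\{z_{n,j}\}$ be a separated triangular family of points in $\mathbb{T}$, and set $$D^-(\mathcal{Z})=\liminf_{R\to\infty}\left(\liminf_{n\to\infty}\frac{\min_{x\in[0,2\pi]}\#\big(\mathcal{Z}(n)\cap(x,x+R/n)\big)}{R}\right).$$ (i) If $D^-(\mathcal{Z})>\frac1{2\pi}$, then $\mathcal{Z}$ is an M-Z family for $L^p$ for every $p\in[1,\infty]$. (ii) Conversely, if $\mathcal{Z}$ is an M-Z family for $L^p$ for some $p\in[1,\infty]$, then $D^-(\mathcal{Z})\ge\frac1{2\pi}$.
   Context: $\mathbb{T}$ is the unit circle in $\mathbb{C}$. $\mathcal{P}_n$ is the space of holomorphic polynomials (complex coefficients, one variable) of degree at most $n$. A triangular family is a collection $\mathcal{Z}=\{z_{n,j}\}$, $n\ge 0$, $0\le j\le m_n$, of points $z_{n,j}\in\mathbb{T}$; its $n$-th generation is $\mathcal{Z}(n)=\{z_{n,0},\dots,z_{n,m_n}\}$. It is assumed that $m_n\ge n$ for all $n$. For $1\le p<\infty$, $\mathcal{Z}$ is an M-Z (Marcinkiewicz-Zygmund) family for $L^p$ if there is a constant $C_p>0$ such that for all $n\ge1$ and all $q\in\mathcal{P}_n$, $$\frac{C_p^{-1}}{m_n}\sum_{j=0}^{m_n}|q(z_{n,j})|^p\le\int_0^{2\pi}|q(e^{i\theta})|^p\,d\theta\le\frac{C_p}{m_n}\sum_{j=0}^{m_n}|q(z_{n,j})|^p.$$ For $p=\infty$, the requirement is that there is $C>0$ such that for all $n\geq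 1$ and $q\in\mathcal{P}_n$, $\sup_{|z|=1}|q(z)|\le C\sup_{0\le j\le m_n}|q(z_{n,j})|$. $\mathcal{Z}$ is separated if there is $\varepsilon>0$ such that $|z_{n,j}-z_{n,k}|\ge\varepsilon/n$ for all $n\ge1$ and all $0\le j,k\le m_n$ with $j\ne k$. For real $x<y$, $(x,y)$ denotes the arc of $\mathbb{T}$ delimited by the endpoints $e^{ix}$ and $e^{iy}$, i.e. $\{e^{i\theta}:x<\theta<y\}$. *)

theory Defs
  imports "HOL-Analysis.Analysis" "HOL-Computational_Algebra.Polynomial"
begin

text \<open>
  A family consists of \<open>m\<close> and \<open>z\<close>, where generation \<open>n\<close> is indexed by \<open>j \<in> {0..m n}\<close>;
  the values \<open>z n j\<close> with \<open>j > m n\<close> are irrelevant.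
\<close>

definition triangular_family :: "(nat \<Rightarrow> nat) \<Rightarrow> (nat \<Rightarrow> nat \<Rightarrow> complex) \<Rightarrow> bool" where
  "triangular_family m z \<longleftrightarrow> (\<forall>n. n \<le> m n) \<and> (\<forall>n. \<forall>j\<in>{0..m n}. z n j \<in> sphere 0 1)"

definition generation :: "(nat \<Rightarrow> nat) \<Rightarrow> (nat \<Rightarrow> nat \<Rightarrow> complex) \<Rightarrow> nat \<Rightarrow> complex set" where
  "generation m z n = z n ` {0..m n}"

definition separated_family :: "(nat \<Rightarrow> nat) \<Rightarrow> (nat \<Rightarrow> nat \<Rightarrow> complex) \<Rightarrow> bool" where
  "separated_family m z \<longleftrightarrow>
     (\<exists>\<epsilon>>0. \<forall>n\<ge>1. \<forall>j\<in>{0..m n}. \<forall>k\<in>{0..m n}. j \<noteq> k \<longrightarrow> dist (z n j) (z n k) \<ge> \<epsilon> / real n)"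

definition MZ_family_finite :: "real \<Rightarrow> (nat \<Rightarrow> nat) \<Rightarrow> (nat \<Rightarrow> nat \<Rightarrow> complex) \<Rightarrow> bool" where
  "MZ_family_finite p m z \<longleftrightarrow>
     (\<exists>C>0. \<forall>n\<ge>1. \<forall>q::complex poly. degree q \<le> n \<longrightarrow>
        inverse C / real (m n) * (\<Sum>j=0..m n. norm (poly q (z n j)) powr p)
          \<le> integral {0..2 * pi} (\<lambda>\<theta>. norm (poly q (cis \<theta>)) powr p) \<and>
        integral {0..2 * pi} (\<lambda>\<theta>. norm (poly q (cis \<theta>)) powr p)
          \<le> C / real (m n) * (\<Sum>j=0..m n. norm (poly q (z n j)) powr p))"

definition MZ_family_infinity :: "(nat \<Rightarrow> nat) \<Rightarrow> (nat \<Rightarrow> nat \<Rightarrow> complex) \<Rightarrow> bool" where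
  "MZ_family_infinity m z \<longleftrightarrow>
     (\<exists>C>0. \<forall>n\<ge>1. \<forall>q::complex poly. degree q \<le> n \<longrightarrow>
        (SUP w\<in>sphere 0 1. norm (poly q w)) \<le> C * (SUP j\<in>{0..m n}. norm (poly q (z n j))))"

text \<open>The exponent ranges over \<open>[1, \<infinity>]\<close>; the definition is only meant for \<open>p \<ge> 1\<close>.\<close>

definition MZ_family :: "ereal \<Rightarrow> (nat \<Rightarrow> nat) \<Rightarrow> (nat \<Rightarrow> nat \<Rightarrow> complex) \<Rightarrow> bool" where
  "MZ_family p m z \<longleftrightarrow>
     (if p = \<infinity> then MZ_family_infinity m z else MZ_family_finite (real_of_ereal p) m z)"

definition open_arc :: "real \<Rightarrow> real \<Rightarrow> complex set" where
  "open_arc x y = cis ` {x<..<y}"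

definition min_arc_count :: "(nat \<Rightarrow> nat) \<Rightarrow> (nat \<Rightarrow> nat \<Rightarrow> complex) \<Rightarrow> nat \<Rightarrow> real \<Rightarrow> nat" where
  "min_arc_count m z n r =
     Min ((\<lambda>x. card (generation m z n \<inter> open_arc x (x + r))) ` {0..2 * pi})"

text \<open>The minimum is over a finite nonempty set of naturals, so it is attained.\<close>

lemma min_arc_count_finite:
  "finite ((\<lambda>x. card (generation m z n \<inter> open_arc x (x + r))) ` {0..2 * pi})"
proof (rule finite_subset)
  show "(\<lambda>x. card (generation m z n \<inter> open_arc x (x + r))) ` {0..2 * pi}
          \<subseteq> {..card (generation m z n)}"
    by (auto simp: generation_def intro!: card_mono)
qed simp

text \<open>
  Both lower limits are taken in the extended reals, and \<open>R\<close> tends to infinity through the reals.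
\<close>

definition lower_density :: "(nat \<Rightarrow> nat) \<Rightarrow> (nat \<Rightarrow> nat \<Rightarrow> complex) \<Rightarrow> ereal" where
  "lower_density m z =
     Liminf at_top (\<lambda>R::real.
       liminf (\<lambda>n. ereal (real (min_arc_count m z n (R / real n)) / R)))"

end

theory Submission imports Defs "HOL-Complex_Analysis.Complex_Analysis" begin

text \<open>
  The localizing kernel is \<open>F\<^sub>M(u) = |dmean M u|\<^sup>2\<close>, where \<open>dmean M\<close> is the normalized Dirichlet kernel
  \<open>(1 + u + \<dots> + u\<^sup>M) / (M + 1)\<close>: it is the modulus on the circle of a polynomial of degree \<open>2 M\<close>, equals \<open>1\<close> at \<open>u = 1\<close>,
  has integral \<open>2 \<pi> / (M + 1)\<close>, and its sum over points that are \<open>\<eta> / (M + 1)\<close>-separated is bounded.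

  Density above \<open>1 / (2 \<pi>)\<close> gives sampling in the maximum norm, for all degrees up to \<open>(1 + e) n\<close>. Rescale \<open>q\<close> around
  a maximum point to the entire function \<open>f(s) = q(w e\<^bsup>is/n\<^esup>) e\<^bsup>-iNs/2n\<^esup>\<close>, whose growth is at most \<open>exp ((1 + e) |Im s| / 2)\<close>;
  subtract the Lagrange interpolant of its (small) values at the rescaled nodes in a long window, and compare
  the growth with the number of zeros by Jensen's formula. The spare degree \<open>e n\<close> pays for multiplying
  \<open>q\<close> by \<open>F\<^sub>M\<close> centred at \<open>w\<close>; integrating over \<open>w\<close> turns the maximum norm estimate into all \<open>L\<^sup>p\<close> estimates.

  Conversely, the same localization turns an \<open>L\<^sup>p\<close> inequality into maximum norm sampling for degrees
  \<open>n - 2 M\<close>. If an arc of length \<open>R / n\<close> had too few nodes, then a nontrivial linear combination of kernels centred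
  at equidistant points of the arc would vanish at these nodes; it decays away from the arc, so
  it is small at all nodes without being small everywhere.
\<close>

section \<open>The localizing kernel\<close>

definition dmean :: "nat \<Rightarrow> complex \<Rightarrow> complex" where
  "dmean M u = (\<Sum>k\<le>M. u ^ k) / of_nat (M + 1)"

lemma dmean_at_one [simp]: "dmean M 1 = 1"
proof -
  have "1 + complex_of_nat M \<noteq> 0" by (metis of_nat_Suc of_nat_neq_0)
  then show ?thesis by (simp add: dmean_def)
qed

lemma norm_dmean_le_1:
  assumes "norm u = 1"
  shows "norm (dmean M u) \<le> 1"
proof -
  have "norm (\<Sum>k\<le>M. u ^ k) \<le> (\<Sum>k\<le>M. norm (u ^ k))" by (rule norm_sum)
  also have "\<dots> = real (M + 1)" using assms by (simp add: norm_power)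
  finally show ?thesis
    unfolding dmean_def norm_divide norm_of_nat by (simp add: divide_le_eq_1)
qed

text \<open>Telescoping of the geometric sum. The product form stays valid at \<open>u = 1\<close>,
  so the decay estimate \<open>dmean_decay\<close> needs no case split.\<close>

lemma dmean_mult: "dmean M u * of_nat (M + 1) * (u - 1) = u ^ (M + 1) - 1"
proof -
  have *: "complex_of_nat (M + 1) \<noteq> 0" by (metis Suc_eq_plus1 of_nat_neq_0)
  have "dmean M u * of_nat (M + 1) = (\<Sum>k<Suc M. u ^ k)"
    using * by (simp add: dmean_def lessThan_Suc_atMost del: of_nat_add of_nat_Suc)
  then show ?thesis
    using power_diff_1_eq[of u "Suc M"] by (simp add: mult.commute del: of_nat_add of_nat_Suc)
qed

lemma dmean_decay:
  assumes "norm u = 1"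
  shows "norm (dmean M u) * real (M + 1) * norm (u - 1) \<le> 2"
proof -
  have "norm (dmean M u) * real (M + 1) * norm (u - 1) = norm (u ^ (M + 1) - 1)"
    by (metis dmean_mult norm_mult norm_of_nat)
  also have "\<dots> \<le> norm (u ^ (M + 1)) + norm (1::complex)" by (rule norm_triangle_ineq4)
  also have "\<dots> = 2" using assms by (simp add: norm_power norm_mult)
  finally show ?thesis .
qed

lemma dmean_root_of_unity:
  assumes "u ^ (M + 1) = 1" "u \<noteq> 1"
  shows "dmean M u = 0"
proof -
  have "dmean M u * of_nat (M + 1) * (u - 1) = 0" using assms dmean_mult by simp
  moreover have "complex_of_nat (M + 1) \<noteq> 0" by (metis Suc_eq_plus1 of_nat_neq_0)
  ultimately show ?thesis using assms by (simp del: of_nat_add of_nat_Suc)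
qed

text \<open>For \<open>w\<close> on the circle \<open>cnj w\<close> is the inverse of
  \<open>w\<close>, so this is the kernel rotated to peak at \<open>w\<close>, in a form by which a
  given polynomial can be multiplied.\<close>

lemma dmean_poly:
  obtains D where "degree D \<le> M" "\<And>z. poly D z = dmean M (z * cnj w)"
proof
  let ?D = "smult (1 / of_nat (M + 1)) (\<Sum>k\<le>M. monom (cnj w ^ k) k)"
  show "degree ?D \<le> M"
    by (intro order.trans[OF degree_smult_le] degree_sum_le)
       (auto intro: order.trans[OF degree_monom_le])
  show "poly ?D z = dmean M (z * cnj w)" for z
    by (simp add: dmean_def poly_sum poly_monom power_mult_distrib mult.commute)
qed

section \<open>Chords and angles on the unit circle\<close>

text \<open>By concavity of the sine on [0, pi/2], its graph lies above the chord joining its end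
  points.\<close>

lemma sin_Jordan:
  assumes "0 \<le> x" "x \<le> pi / 2"
  shows "2 / pi * x \<le> sin x"
proof -
  have "convex_on {0..pi/2} (\<lambda>x. - sin x)"
    by (rule convex_on_realI[where f' = "\<lambda>x. - cos x"])
       (auto intro!: derivative_eq_intros cos_monotone_0_pi_le)
  then have "- sin ((1 - 2 / pi * x) *\<^sub>R 0 + (2 / pi * x) *\<^sub>R (pi/2))
       \<le> (1 - 2 / pi * x) * - sin 0 + (2 / pi * x) * - sin (pi/2)"
    using assms by (intro convex_onD) (auto simp: field_simps)
  then show ?thesis by simp
qed

lemma norm_cis_minus_1: "norm (cis t - 1) = 2 * \<bar>sin (t / 2)\<bar>"
proof -
  have "(norm (cis t - 1))\<^sup>2 = (2 * \<bar>sin (t / 2)\<bar>)\<^sup>2"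
  proof -
    have "(norm (cis t - 1))\<^sup>2 = (cos t - 1)\<^sup>2 + (sin t)\<^sup>2"
      by (simp add: cmod_power2)
    also have "\<dots> = (cos t)\<^sup>2 + (sin t)\<^sup>2 + 1 - 2 * cos t" by (simp add: power2_eq_square algebra_simps)
    also have "\<dots> = 2 - 2 * cos (2 * (t/2))" by simp
    also have "\<dots> = 4 * (sin (t/2))\<^sup>2" by (subst cos_double_sin) simp
    finally show ?thesis by (simp add: power_mult_distrib)
  qed
  then show ?thesis by (rule power2_eq_imp_eq) auto
qed

text \<open>The half-angle formula expresses the chord by a sine at an angle of modulus at most
  pi/2, where Jordan's inequality applies. This turns decay in the chord into decay in the
  angle.\<close>

lemma chord_ge:
  assumes "\<bar>t\<bar> \<le> pi"
  shows "2 / pi * \<bar>t\<bar> \<le> norm (cis t - 1)"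
proof -
  have "2 / pi * (\<bar>t\<bar> / 2) \<le> sin (\<bar>t\<bar> / 2)" using assms by (intro sin_Jordan) auto
  moreover have "sin (\<bar>t\<bar> / 2) \<le> \<bar>sin (t / 2)\<bar>" by (auto simp: abs_if)
  ultimately have "2 / pi * (\<bar>t\<bar> / 2) \<le> \<bar>sin (t / 2)\<bar>" by linarith
  then show ?thesis unfolding norm_cis_minus_1 by simp
qed

lemma chord_le: "norm (cis a - cis b) \<le> \<bar>a - b\<bar>"
proof -
  have "cis a - cis b = cis b * (cis (a - b) - 1)"
    by (simp add: algebra_simps cis_mult)
  then have "norm (cis a - cis b) = norm (cis (a - b) - 1)" by (simp add: norm_mult)
  also have "\<dots> = 2 * \<bar>sin ((a - b) / 2)\<bar>" by (rule norm_cis_minus_1)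
  also have "\<dots> \<le> 2 * \<bar>(a - b) / 2\<bar>" by (intro mult_left_mono abs_sin_x_le_abs_x) auto
  finally show ?thesis by simp
qed

lemma norm_diff_unit:
  assumes "norm w = 1"
  shows "norm (z * cnj w - 1) = norm (z - w)"
proof -
  have "w * cnj w = 1" using assms by (simp add: complex_norm_square[symmetric])
  then have "z * cnj w - 1 = (z - w) * cnj w" by (simp add: algebra_simps)
  then show ?thesis using assms by (simp add: norm_mult)
qed

section \<open>Kernel sums over separated points\<close>

lemma sum_inverse_square_int_le:
  fixes A :: "int set"
  assumes "finite A"
  shows "(\<Sum>k\<in>A. 1 / (1 + real_of_int k ^ 2)) \<le> 4"
proof -
  obtain N :: nat where N: "A \<subseteq> {- int N..int N}"
  proof -
    have "A \<subseteq> {- int (nat (\<Sum>k\<in>A. \<bar>k\<bar>))..int (nat (\<Sum>k\<in>A. \<bar>k\<bar>))}"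
    proof
      fix x assume "x \<in> A"
      then have "\<bar>x\<bar> \<le> (\<Sum>k\<in>A. \<bar>k\<bar>)" using assms by (intro member_le_sum) auto
      then show "x \<in> {- int (nat (\<Sum>k\<in>A. \<bar>k\<bar>))..int (nat (\<Sum>k\<in>A. \<bar>k\<bar>))}" by auto
    qed
    then show ?thesis using that by blast
  qed
  have "(\<Sum>k\<in>A. 1 / (1 + real_of_int k ^ 2)) \<le> (\<Sum>k\<in>{- int N..int N}. 1 / (1 + real_of_int k ^ 2))"
    using N by (intro sum_mono2) auto
  \<comment> \<open>The bound 4 is sharpened so that induction works: the two new terms together are
    at most 3 / (N + 1) - 3 / (N + 2).\<close>
  also have "\<dots> \<le> 4 - 3 / (real N + 1)"
  proof (induction N)
    case 0 then show ?case by simp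
  next
    case (Suc N)
    have "{- int (Suc N)..int (Suc N)} = insert (- int (Suc N)) (insert (int (Suc N)) {- int N..int N})"
      by auto
    then have "(\<Sum>k\<in>{- int (Suc N)..int (Suc N)}. 1 / (1 + real_of_int k ^ 2))
       = 2 / (1 + (real N + 1)^2) + (\<Sum>k\<in>{- int N..int N}. 1 / (1 + real_of_int k ^ 2))"
      by (simp add: algebra_simps power2_eq_square)
    also have "\<dots> \<le> 2 / (1 + (real N + 1)^2) + (4 - 3 / (real N + 1))" using Suc by simp
    also have "\<dots> \<le> 4 - 3 / (real (Suc N) + 1)"
    proof -
      have "2 / (1 + (real N + 1)^2) \<le> 3 / ((real N + 1) * (real N + 2))"
        by (simp add: divide_simps power2_eq_square add_pos_nonneg; simp add: algebra_simps)
      also have "\<dots> = 3 / (real N + 1) - 3 / (real (Suc N) + 1)"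
        by (simp add: field_simps)
      finally show ?thesis by simp
    qed
    finally show ?case .
  qed
  also have "\<dots> \<le> 4" by simp
  finally show ?thesis .
qed

text \<open>Centre and argument of the kernel may be exchanged, so a sum over centres is also a sum
  over points.\<close>

lemma norm_dmean_swap: "norm (dmean M (z * cnj w)) = norm (dmean M (w * cnj z))"
proof -
  have "dmean M (z * cnj w) = cnj (dmean M (w * cnj z))"
    by (simp add: dmean_def mult.commute)
  then show ?thesis by simp
qed

lemma continuous_on_dmean [continuous_intros]:
  assumes "continuous_on S f"
  shows "continuous_on S (\<lambda>x. dmean M (f x))"
  unfolding dmean_def
  by (intro continuous_intros assms) (metis Suc_eq_plus1 of_nat_neq_0)

text \<open>Measure angles from \<open>w\<close> and cut them into cells of length \<open>h\<close>.
  Since an arc is at least as long as its chord, distinct points lie in distinct cells, and the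
  decay of the kernel makes the term in cell \<open>k\<close> at most a constant times 1 / (1 +
  k^2).\<close>

lemma sum_kernel_separated_le:
  assumes fin: "finite J" and unit: "\<And>j. j \<in> J \<Longrightarrow> norm (z j) = 1" and w: "norm w = 1"
    and \<eta>: "\<eta> > 0"
    and sep: "\<And>j k. j \<in> J \<Longrightarrow> k \<in> J \<Longrightarrow> j \<noteq> k \<Longrightarrow> \<eta> / real (M + 1) \<le> norm (z j - z k)"
  shows "(\<Sum>j\<in>J. norm (dmean M (z j * cnj w)) ^ 2) \<le> 12 + 8 * pi\<^sup>2 / \<eta>\<^sup>2"
proof -
  define h where "h = \<eta> / real (M + 1)"
  have h: "h > 0" using \<eta> by (simp add: h_def)
  define t where "t = (\<lambda>j. Arg (z j * cnj w))"
  define k where "k = (\<lambda>j. \<lfloor>t j / h\<rfloor>)"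
  have t: "cis (t j) = z j * cnj w" "\<bar>t j\<bar> \<le> pi" if "j \<in> J" for j
  proof -
    have "norm (z j * cnj w) = 1" using unit[OF that] w by (simp add: norm_mult)
    moreover from this have "z j * cnj w \<noteq> 0" by auto
    ultimately show "cis (t j) = z j * cnj w"
      unfolding t_def by (metis cis_Arg sgn_div_norm div_by_1 inverse_1 scaleR_one)
    show "\<bar>t j\<bar> \<le> pi" unfolding t_def using Arg_bounded[of "z j * cnj w"] by linarith
  qed
  have inj: "inj_on k J"
  proof (rule inj_onI, rule ccontr)
    fix i j assume ij: "i \<in> J" "j \<in> J" "k i = k j" "i \<noteq> j"
    have "\<bar>t i / h - t j / h\<bar> < 1" using ij(3) unfolding k_def by linarith
    then have "\<bar>t i - t j\<bar> < h" using h by (simp add: diff_divide_distrib[symmetric])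
    moreover have "norm (z i - z j) = norm (cis (t i) - cis (t j))"
      using w ij by (simp add: t left_diff_distrib[symmetric] norm_mult)
    ultimately show False
      using chord_le[of "t i" "t j"] sep[OF ij(1,2,4)] unfolding h_def by linarith
  qed
  have bound: "norm (dmean M (z j * cnj w)) ^ 2 \<le> (3 + 2 * pi\<^sup>2 / \<eta>\<^sup>2) * (1 / (1 + real_of_int (k j) ^ 2))"
    if j: "j \<in> J" for j
  proof -
    let ?d = "norm (dmean M (z j * cnj w))"
    have u: "norm (z j * cnj w) = 1" using unit[OF j] w by (simp add: norm_mult)
    have d1: "?d ^ 2 \<le> 1" using norm_dmean_le_1[OF u] by (simp add: power_le_one)
    have "?d * real (M + 1) * (2 / pi * \<bar>t j\<bar>) \<le> ?d * real (M + 1) * norm (z j * cnj w - 1)"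
      using chord_ge[OF t(2)[OF j]] t(1)[OF j] by (intro mult_left_mono) auto
    also have "\<dots> \<le> 2" by (rule dmean_decay[OF u])
    finally have "?d * real (M + 1) * \<bar>t j\<bar> \<le> pi" by (simp add: field_simps)
    then have "?d * \<bar>t j / h\<bar> \<le> pi / \<eta>"
      using \<eta> by (simp add: h_def abs_mult abs_divide field_simps del: of_nat_add of_nat_Suc)
    then have "(?d * \<bar>t j / h\<bar>)\<^sup>2 \<le> (pi / \<eta>)\<^sup>2" by (intro power_mono) auto
    then have d2: "?d ^ 2 * (t j / h)\<^sup>2 \<le> pi\<^sup>2 / \<eta>\<^sup>2"
      by (simp add: power_mult_distrib power_divide)
    \<comment> \<open>The decay is known in terms of \<open>t j / h\<close>; passing to its floor
      costs at most 1, hence the inequality (y + 1)^2 \<le> 2 y^2 + 2.\<close>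
    have "\<bar>real_of_int (k j)\<bar> \<le> \<bar>t j / h\<bar> + 1" unfolding k_def by linarith
    then have "\<bar>real_of_int (k j)\<bar> ^ 2 \<le> (\<bar>t j / h\<bar> + 1) ^ 2" by (intro power_mono) auto
    also have "\<dots> \<le> 2 * (t j / h)\<^sup>2 + 2"
    proof -
      have "(y + 1)\<^sup>2 \<le> 2 * y\<^sup>2 + 2" for y :: real
        using zero_le_power2[of "y - 1"] by (simp add: power2_eq_square algebra_simps)
      from this[of "\<bar>t j / h\<bar>"] show ?thesis by (simp only: power2_abs)
    qed
    finally have "1 + real_of_int (k j) ^ 2 \<le> 3 + 2 * (t j / h)\<^sup>2" by simp
    then have "?d ^ 2 * (1 + real_of_int (k j) ^ 2) \<le> ?d ^ 2 * (3 + 2 * (t j / h)\<^sup>2)"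
      by (intro mult_left_mono) auto
    also have "\<dots> = 3 * ?d ^ 2 + 2 * (?d ^ 2 * (t j / h)\<^sup>2)" by (simp add: algebra_simps)
    also have "\<dots> \<le> 3 + 2 * (pi\<^sup>2 / \<eta>\<^sup>2)" using d1 d2 by linarith
    finally show ?thesis by (simp add: pos_le_divide_eq add_pos_nonneg)
  qed
  have "(\<Sum>j\<in>J. norm (dmean M (z j * cnj w)) ^ 2)
      \<le> (\<Sum>j\<in>J. (3 + 2 * pi\<^sup>2 / \<eta>\<^sup>2) * (1 / (1 + real_of_int (k j) ^ 2)))"
    by (intro sum_mono bound)
  also have "\<dots> = (3 + 2 * pi\<^sup>2 / \<eta>\<^sup>2) * (\<Sum>i\<in>k ` J. 1 / (1 + real_of_int i ^ 2))"
    by (simp add: sum.reindex[OF inj] sum_distrib_left)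
  also have "\<dots> \<le> (3 + 2 * pi\<^sup>2 / \<eta>\<^sup>2) * 4"
    using fin by (intro mult_left_mono sum_inverse_square_int_le) auto
  finally show ?thesis by simp
qed

section \<open>Integrals of exponentials and of the kernel\<close>

lemma has_integral_cis_int:
  "((\<lambda>t. cis (real_of_int n * t)) has_integral (if n = 0 then 2 * complex_of_real pi else 0)) {0..2 * pi}"
proof (cases "n = 0")
  case True
  have "((\<lambda>t. 1::complex) has_integral (2 * pi - 0) *\<^sub>R 1) {0..2 * pi}"
    using has_integral_const_real[of "1::complex" 0 "2 * pi"] by simp
  then show ?thesis using True by (simp add: scaleR_conv_of_real)
next
  case False
  let ?F = "\<lambda>t. cis (real_of_int n * t) / (\<i> * of_int n)"
  have "((\<lambda>t. cis (real_of_int n * t)) has_integral ?F (2 * pi) - ?F 0) {0..2 * pi}"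
  proof (rule fundamental_theorem_of_calculus)
    show "(?F has_vector_derivative cis (real_of_int n * x)) (at x within {0..2 * pi})" for x
    proof -
      have "((\<lambda>t. exp (\<i> * of_int n * t) / (\<i> * of_int n)) has_field_derivative
          exp (\<i> * of_int n * of_real x)) (at (of_real x :: complex))"
        using False by (auto intro!: derivative_eq_intros)
      then have "((\<lambda>t. exp (\<i> * of_int n * of_real t) / (\<i> * of_int n)) has_vector_derivative
          exp (\<i> * of_int n * of_real x)) (at x)"
        by (rule has_vector_derivative_real_field)
      then show ?thesis
        by (auto simp: cis_conv_exp mult.assoc intro: has_vector_derivative_at_within)
    qed
  qed simp
  moreover have "?F (2 * pi) = ?F 0"
    by (simp add: cis_multiple_2pi mult.commute[of _ "2 * pi"])
  ultimately show ?thesis using False by simp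
qed

text \<open>Parseval: in the expansion as a double sum only the M + 1 diagonal terms have nonzero
  integral, and each contributes 2 pi / (M + 1)^2.\<close>

lemma has_integral_norm_dmean_square:
  assumes w: "norm w = 1"
  shows "((\<lambda>t. norm (dmean M (cis t * cnj w)) ^ 2) has_integral 2 * pi / real (M + 1)) {0..2 * pi}"
proof -
  have M: "1 + complex_of_nat M \<noteq> 0" by (metis of_nat_Suc of_nat_neq_0)
  have ww: "cnj w ^ j * w ^ j = 1" for j
    using w by (metis complex_norm_square mult.commute one_power2 of_real_1 power_mult_distrib power_one)
  let ?f = "\<lambda>t. \<Sum>j\<le>M. \<Sum>k\<le>M. cnj w ^ j * w ^ k / (of_nat (M + 1))\<^sup>2 * cis (real_of_int (int j - int k) * t)"
  have eq: "complex_of_real (norm (dmean M (cis t * cnj w)) ^ 2) = ?f t" for t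
  proof -
    have "complex_of_real (norm (dmean M (cis t * cnj w)) ^ 2)
        = dmean M (cis t * cnj w) * cnj (dmean M (cis t * cnj w))"
      by (metis of_real_power complex_norm_square)
    also have "\<dots> = (\<Sum>j\<le>M. (cis t * cnj w) ^ j) * (\<Sum>k\<le>M. (cis (-t) * w) ^ k) / (of_nat (M + 1))\<^sup>2"
      by (simp add: dmean_def cis_cnj power2_eq_square)
    also have "\<dots> = (\<Sum>j\<le>M. \<Sum>k\<le>M. (cis t * cnj w) ^ j * (cis (-t) * w) ^ k / (of_nat (M + 1))\<^sup>2)"
      by (simp only: sum_product sum_divide_distrib)
    also have "\<dots> = ?f t"
    proof (intro sum.cong refl)
      fix j k
      have "cis t ^ j * cis (- t) ^ k = cis (real_of_int (int j - int k) * t)"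
        by (simp only: Complex.DeMoivre cis_mult) (simp add: algebra_simps)
      then show "(cis t * cnj w) ^ j * (cis (-t) * w) ^ k / (of_nat (M + 1))\<^sup>2
        = cnj w ^ j * w ^ k / (of_nat (M + 1))\<^sup>2 * cis (real_of_int (int j - int k) * t)"
        by (simp add: power_mult_distrib)
    qed
    finally show ?thesis .
  qed
  have "(?f has_integral (\<Sum>j\<le>M. \<Sum>k\<le>M. cnj w ^ j * w ^ k / (of_nat (M + 1))\<^sup>2 *
      (if int j - int k = 0 then 2 * complex_of_real pi else 0))) {0..2 * pi}"
    by (intro has_integral_sum has_integral_mult_right has_integral_cis_int) auto
  also have "(\<Sum>j\<le>M. \<Sum>k\<le>M. cnj w ^ j * w ^ k / (of_nat (M + 1))\<^sup>2 *
      (if int j - int k = 0 then 2 * complex_of_real pi else 0)) = (\<Sum>j\<le>M. 2 * complex_of_real pi / (of_nat (M + 1))\<^sup>2)"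
  proof (intro sum.cong refl)
    fix j assume "j \<in> {..M}"
    have "(\<Sum>k\<le>M. cnj w ^ j * w ^ k / (of_nat (M + 1))\<^sup>2 *
        (if int j - int k = 0 then 2 * complex_of_real pi else 0))
      = (\<Sum>k\<le>M. if k = j then cnj w ^ j * w ^ j * (2 * pi / (of_nat (M + 1))\<^sup>2) else 0)"
      by (intro sum.cong) auto
    also have "\<dots> = 2 * pi / (of_nat (M + 1))\<^sup>2"
      using \<open>j \<in> {..M}\<close> by (simp add: ww)
    finally show "(\<Sum>k\<le>M. cnj w ^ j * w ^ k / (of_nat (M + 1))\<^sup>2 *
        (if int j - int k = 0 then 2 * complex_of_real pi else 0)) = 2 * complex_of_real pi / (of_nat (M + 1))\<^sup>2"
      by simp
  qed
  also have "\<dots> = complex_of_real (2 * pi / real (M + 1))"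
    using M by (simp add: power2_eq_square)
  finally have "((\<lambda>t. complex_of_real (norm (dmean M (cis t * cnj w)) ^ 2)) has_integral
      complex_of_real (2 * pi / real (M + 1))) {0..2 * pi}"
    by (simp only: eq)
  from has_integral_Re[OF this] show ?thesis by simp
qed

section \<open>Point evaluations and integral means\<close>

text \<open>A coefficient is a Fourier coefficient of the boundary function, that is, a mean of
  \<open>P\<close> against a unimodular exponential.\<close>

lemma norm_coeff_le:
  fixes P :: "complex poly"
  shows "norm (coeff P k) \<le> integral {0..2 * pi} (\<lambda>t. norm (poly P (cis t))) / (2 * pi)"
proof -
  let ?g = "\<lambda>t. poly P (cis t) * cis (- real k * t)"
  have "?g = (\<lambda>t. \<Sum>i\<le>degree P. coeff P i * cis (real_of_int (int i - int k) * t))"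
  proof (intro ext)
    fix t
    have "cis t ^ i * cis (- real k * t) = cis (real_of_int (int i - int k) * t)" for i
      by (simp only: Complex.DeMoivre cis_mult) (simp add: algebra_simps)
    then show "?g t = (\<Sum>i\<le>degree P. coeff P i * cis (real_of_int (int i - int k) * t))"
      by (simp only: poly_altdef sum_distrib_right mult.assoc)
  qed
  moreover have "((\<lambda>t. \<Sum>i\<le>degree P. coeff P i * cis (real_of_int (int i - int k) * t)) has_integral
      (\<Sum>i\<le>degree P. coeff P i * (if int i - int k = 0 then 2 * complex_of_real pi else 0))) {0..2 * pi}"
    by (intro has_integral_sum has_integral_mult_right has_integral_cis_int) auto
  moreover have "(\<Sum>i\<le>degree P. coeff P i * (if int i - int k = 0 then 2 * complex_of_real pi else 0))
      = (\<Sum>i\<le>degree P. if i = k then coeff P k * (2 * complex_of_real pi) else 0)"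
    by (intro sum.cong) auto
  moreover have "\<dots> = coeff P k * (2 * pi)"
    by (auto simp: coeff_eq_0)
  ultimately have int: "(?g has_integral coeff P k * (2 * pi)) {0..2 * pi}" by simp
  have "norm (integral {0..2 * pi} ?g) \<le> integral {0..2 * pi} (\<lambda>t. norm (poly P (cis t)))"
    by (rule integral_norm_bound_integral)
       (auto intro!: integrable_continuous_real continuous_intros simp: norm_mult)
  then show ?thesis
    using integral_unique[OF int] by (simp add: norm_mult field_simps)
qed

text \<open>Convexity of the power function. The point \<open>x = 0\<close> is treated separately
  because convexity is used on the open half line.\<close>

lemma powr_ge_tangent:
  fixes x y p :: real
  assumes "x \<ge> 0" "y > 0" "p \<ge> 1"
  shows "y powr p + p * y powr (p - 1) * (x - y) \<le> x powr p"
proof -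
  have "p * y powr (p - 1) * (x - y) \<le> x powr p - y powr p"
  proof (cases "x = 0")
    case True
    have "y powr (p - 1) * y = y powr p"
      using assms powr_mult_base[of y "p - 1"] by (simp add: mult.commute)
    then have "p * y powr (p - 1) * (x - y) = - (p * y powr p)" using True by simp
    also have "\<dots> \<le> - (1 * y powr p)" using assms by (intro le_imp_neg_le mult_right_mono) auto
    finally show ?thesis using True by simp
  next
    case False
    show ?thesis
    proof (rule convex_on_imp_above_tangent[where A = "{0<..}"])
      show "convex_on {0<..} (\<lambda>x::real. x powr p)" using powr_convex[OF assms(3)] .
      show "((\<lambda>x. x powr p) has_real_derivative p * y powr (p - 1)) (at y within {0<..})"
        using assms has_real_derivative_powr[of y p] by (auto intro: has_field_derivative_at_within)
    qed (use assms False in \<open>auto simp: interior_open\<close>)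
  qed
  then show ?thesis by simp
qed

text \<open>
  The polynomial \<open>q D\<^sup>2\<close>, with \<open>D\<close> the kernel polynomial centred at \<open>w\<close>, has at most \<open>3 n + 1\<close> coefficients, each bounded
  by its mean modulus, and it agrees with \<open>q\<close> at \<open>w\<close>. Jensen's inequality for the
  probability density \<open>(n + 1) F\<^sub>n / (2 \<pi>)\<close> then gives all \<open>p \<ge> 1\<close>.
\<close>

lemma point_bound:
  fixes q :: "complex poly"
  assumes w: "norm w = 1" and deg: "degree q \<le> n" and p: "p \<ge> 1"
  shows "norm (poly q w) powr p \<le> 3 powr p * (real (n + 1) / (2 * pi)) *
     integral {0..2 * pi} (\<lambda>t. norm (poly q (cis t)) powr p * norm (dmean n (cis t * cnj w)) ^ 2)"
proof -
  let ?F = "\<lambda>t. norm (dmean n (cis t * cnj w)) ^ 2"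
  let ?x = "\<lambda>t. norm (poly q (cis t))"
  define c where "c = real (n + 1) / (2 * pi)"
  have c: "c > 0" by (simp add: c_def)
  define E where "E = c * integral {0..2 * pi} (\<lambda>t. ?x t * ?F t)"
  have int1: "(\<lambda>t. ?x t * ?F t) integrable_on {0..2 * pi}"
    by (intro integrable_continuous_real continuous_intros)
  have intp: "(\<lambda>t. ?x t powr p * ?F t) integrable_on {0..2 * pi}"
    using p by (intro integrable_continuous_real continuous_intros continuous_on_powr') auto
  have E0: "E \<ge> 0" unfolding E_def using c by (intro mult_nonneg_nonneg integral_nonneg int1) auto
  obtain D where D: "degree D \<le> n" "\<And>z. poly D z = dmean n (z * cnj w)"
    using dmean_poly by blast
  define P where "P = q * D * D"
  have degP: "degree P \<le> 3 * n"
    using degree_mult_le[of "q * D" D] degree_mult_le[of q D] deg D(1) unfolding P_def by linarith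
  have "w * cnj w = 1" using w by (simp add: complex_norm_square[symmetric])
  then have "poly P w = poly q w" by (simp add: P_def D)
  moreover have "norm (poly P w) \<le> (\<Sum>i\<le>degree P. norm (coeff P i))"
    unfolding poly_altdef by (rule order.trans[OF norm_sum]) (simp add: norm_mult norm_power w)
  moreover have "\<dots> \<le> (\<Sum>i\<le>degree P. integral {0..2 * pi} (\<lambda>t. norm (poly P (cis t))) / (2 * pi))"
    by (intro sum_mono norm_coeff_le)
  moreover have "(\<lambda>t. norm (poly P (cis t))) = (\<lambda>t. ?x t * ?F t)"
    by (auto simp: P_def D norm_mult power2_eq_square)
  moreover have "(\<Sum>i\<le>degree P. integral {0..2 * pi} (\<lambda>t. ?x t * ?F t) / (2 * pi)) \<le> 3 * E"
  proof -
    have I: "integral {0..2 * pi} (\<lambda>t. ?x t * ?F t) / (2 * pi) \<ge> 0"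
      by (intro divide_nonneg_nonneg integral_nonneg int1) auto
    have "degree P + 1 \<le> 3 * (n + 1)" using degP by simp
    then have "real (degree P + 1) \<le> 3 * real (n + 1)" by (metis of_nat_le_iff of_nat_mult of_nat_numeral)
    from mult_right_mono[OF this I] show ?thesis
      by (simp add: E_def c_def algebra_simps add_divide_distrib)
  qed
  ultimately have le: "norm (poly q w) \<le> 3 * E" by simp
  have Jensen: "E powr p \<le> c * integral {0..2 * pi} (\<lambda>t. ?x t powr p * ?F t)"
  proof (cases "E = 0")
    case True
    then show ?thesis using c p by (auto intro!: mult_nonneg_nonneg integral_nonneg intp)
  next
    case False
    then have E: "E > 0" using E0 by simp
    \<comment> \<open>\<open>b\<close> is the slope of the tangent to the p-th power at the mean
      \<open>E\<close>. Integrating the tangent inequality against the kernel cancels the linear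
      term, because \<open>E\<close> is the mean of the modulus.\<close>
    define b where "b = p * E powr (p - 1)"
    have intF: "(?F has_integral 1 / c) {0..2 * pi}"
      using has_integral_norm_dmean_square[OF w, of n] by (simp add: c_def)
    have "((\<lambda>t. (E powr p - b * E) * ?F t + b * (?x t * ?F t)) has_integral
        (E powr p - b * E) * (1 / c) + b * (E / c)) {0..2 * pi}"
      using c integrable_integral[OF int1]
      by (intro has_integral_add has_integral_mult_right intF) (simp add: E_def)
    moreover have "(E powr p - b * E) * (1 / c) + b * (E / c) = E powr p / c"
      using c by (simp add: field_simps)
    moreover have "(E powr p - b * E) * ?F t + b * (?x t * ?F t) \<le> ?x t powr p * ?F t" for t
    proof -
      have "E powr p + b * (?x t - E) \<le> ?x t powr p"
        unfolding b_def using powr_ge_tangent[OF _ E p] by simp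
      from mult_right_mono[OF this, of "?F t"] show ?thesis by (simp add: algebra_simps)
    qed
    ultimately have "E powr p / c \<le> integral {0..2 * pi} (\<lambda>t. ?x t powr p * ?F t)"
      by (metis (no_types, lifting) has_integral_le integrable_integral intp)
    then show ?thesis using c by (simp add: field_simps)
  qed
  have "norm (poly q w) powr p \<le> (3 * E) powr p"
    using le p by (intro powr_mono2) auto
  also have "\<dots> = 3 powr p * E powr p" using E0 by (simp add: powr_mult)
  also have "\<dots> \<le> 3 powr p * (c * integral {0..2 * pi} (\<lambda>t. ?x t powr p * ?F t))"
    using Jensen by (intro mult_left_mono) auto
  finally show ?thesis by (simp add: c_def mult.assoc)
qed

text \<open>Summing \<open>point_bound\<close> over the points and exchanging sum and integral
  leaves, for each fixed \<open>t\<close>, a kernel sum over separated points, which is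
  bounded.\<close>

lemma sum_point_bound:
  fixes q :: "complex poly"
  assumes fin: "finite J" and unit: "\<And>j. j \<in> J \<Longrightarrow> norm (z j) = 1" and \<eta>: "\<eta> > 0"
    and sep: "\<And>j k. j \<in> J \<Longrightarrow> k \<in> J \<Longrightarrow> j \<noteq> k \<Longrightarrow> \<eta> / real (n + 1) \<le> norm (z j - z k)"
    and deg: "degree q \<le> n" and p: "p \<ge> 1"
  shows "(\<Sum>j\<in>J. norm (poly q (z j)) powr p) \<le>
     3 powr p * (real (n + 1) / (2 * pi)) * (12 + 8 * pi\<^sup>2 / \<eta>\<^sup>2) *
     integral {0..2 * pi} (\<lambda>t. norm (poly q (cis t)) powr p)"
proof -
  let ?F = "\<lambda>j t. norm (dmean n (cis t * cnj (z j))) ^ 2"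
  let ?x = "\<lambda>t. norm (poly q (cis t))"
  define A where "A = 3 powr p * (real (n + 1) / (2 * pi))"
  define B where "B = 12 + 8 * pi\<^sup>2 / \<eta>\<^sup>2"
  have A: "A \<ge> 0" by (simp add: A_def)
  have intp: "(\<lambda>t. ?x t powr p * ?F j t) integrable_on {0..2 * pi}" for j
    using p by (intro integrable_continuous_real continuous_intros continuous_on_powr') auto
  have intq: "(\<lambda>t. ?x t powr p) integrable_on {0..2 * pi}"
    using p by (intro integrable_continuous_real continuous_intros continuous_on_powr') auto
  have "(\<Sum>j\<in>J. norm (poly q (z j)) powr p) \<le> (\<Sum>j\<in>J. A * integral {0..2 * pi} (\<lambda>t. ?x t powr p * ?F j t))"
    unfolding A_def by (intro sum_mono point_bound unit deg p)
  also have "\<dots> = A * integral {0..2 * pi} (\<lambda>t. \<Sum>j\<in>J. ?x t powr p * ?F j t)"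
    by (simp add: integral_sum[OF fin intp] sum_distrib_left)
  also have "\<dots> \<le> A * integral {0..2 * pi} (\<lambda>t. B * ?x t powr p)"
  proof (intro mult_left_mono integral_le A)
    show "(\<lambda>t. \<Sum>j\<in>J. ?x t powr p * ?F j t) integrable_on {0..2 * pi}"
      by (intro integrable_sum fin intp)
    show "(\<lambda>t. B * ?x t powr p) integrable_on {0..2 * pi}"
      using intq by (rule integrable_on_mult_right)
    fix t
    have "(\<Sum>j\<in>J. ?F j t) \<le> B"
      unfolding B_def norm_dmean_swap[of n "cis t"] by (intro sum_kernel_separated_le fin unit \<eta> sep) auto
    from mult_left_mono[OF this, of "?x t powr p"]
    show "(\<Sum>j\<in>J. ?x t powr p * ?F j t) \<le> B * ?x t powr p"
      by (simp add: sum_distrib_left mult.commute)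
  qed
  also have "\<dots> = A * B * integral {0..2 * pi} (\<lambda>t. ?x t powr p)" by simp
  finally show ?thesis unfolding A_def B_def .
qed

section \<open>Zeros and growth\<close>

text \<open>The zeros are divided out one at a time. The current quotient vanishes at the next zero
  \<open>a\<close>, since the factors already split off do not.\<close>

lemma holomorphic_factor_zeros:
  assumes "finite \<Lambda>" "h holomorphic_on UNIV" "\<And>l. l \<in> \<Lambda> \<Longrightarrow> h l = 0"
  obtains g where "g holomorphic_on UNIV" "\<And>s. h s = g s * (\<Prod>l\<in>\<Lambda>. s - l)"
proof -
  have "\<exists>g. g holomorphic_on UNIV \<and> (\<forall>s. h s = g s * (\<Prod>l\<in>\<Lambda>. s - l))"
    using assms
  proof (induction \<Lambda> rule: finite_induct)
    case empty
    then show ?case by auto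
  next
    case (insert a \<Lambda>)
    then obtain g where g: "g holomorphic_on UNIV" "\<And>s. h s = g s * (\<Prod>l\<in>\<Lambda>. s - l)" by auto
    have "(\<Prod>l\<in>\<Lambda>. a - l) \<noteq> 0" using insert by auto
    then have ga: "g a = 0" using insert.prems(2)[of a] g(2)[of a] by simp
    \<comment> \<open>The difference quotient at \<open>a\<close>, with the removable singularity
      filled by the derivative.\<close>
    let ?g = "\<lambda>z. if z = a then deriv g a else (g z - g a) / (z - a)"
    have "?g holomorphic_on UNIV" by (rule pole_lemma[OF g(1)]) simp
    moreover have "h s = ?g s * (\<Prod>l\<in>insert a \<Lambda>. s - l)" for s
      using insert.hyps ga by (simp add: g(2))
    ultimately show ?case by blast
  qed
  then show ?thesis using that by blast
qed

section \<open>Discrete means of the modulus of the sine\<close>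

text \<open>The modulus of the sine has period pi, so shifting by one step pi / K only moves the
  first term to the end.\<close>

lemma sum_abs_sin_shift:
  fixes \<theta> :: real
  assumes K: "K \<ge> (1::nat)"
  shows "(\<Sum>j<K. \<bar>sin (\<theta> + real m * (pi / K) + pi * real j / K)\<bar>) = (\<Sum>j<K. \<bar>sin (\<theta> + pi * real j / K)\<bar>)"
proof (induction m)
  case 0 then show ?case by simp
next
  case (Suc m)
  let ?f = "\<lambda>j. \<bar>sin (\<theta> + real m * (pi / K) + pi * real j / K)\<bar>"
  have "(\<Sum>j<K. \<bar>sin (\<theta> + real (Suc m) * (pi / K) + pi * real j / K)\<bar>) = (\<Sum>j<K. ?f (Suc j))"
    by (simp add: distrib_left distrib_right add_divide_distrib add_ac)
  also have "\<dots> = (\<Sum>j<Suc K. ?f j) - ?f 0" by (simp only: sum.lessThan_Suc_shift)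
  also have "\<dots> = (\<Sum>j<K. ?f j) + ?f K - ?f 0" by simp
  also have "?f K = ?f 0" using K by simp
  finally show ?case using Suc by simp
qed

text \<open>After a shift of \<theta> into [0, pi / K] all sines are nonnegative and their sum
  telescopes. For large \<open>K\<close> the bound behaves like 2 K / pi, so it matches the integral
  mean 2 / pi.\<close>

lemma sum_abs_sin_le:
  fixes \<theta> :: real
  assumes K: "K \<ge> (1::nat)"
  shows "(\<Sum>j<K. \<bar>sin (\<theta> + pi * real j / K)\<bar>) \<le> 1 / sin (pi / (2 * real K))"
proof -
  have *: "(\<Sum>j<K. \<bar>sin (\<theta> + pi * real j / K)\<bar>) \<le> 1 / sin (pi / (2 * real K))"
    if \<theta>: "0 \<le> \<theta>" "\<theta> \<le> pi / K" for \<theta> :: real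
  proof -
    have s: "sin (pi / (2 * real K)) > 0"
      using K by (intro sin_gt_zero) (auto simp: field_simps)
    have tele: "2 * sin (pi / (2 * real K)) * (\<Sum>j<n. sin (\<theta> + pi * real j / K))
        = cos (\<theta> - pi / (2 * real K)) - cos (\<theta> + pi * real n / K - pi / (2 * real K))" for n
    proof (induction n)
      case 0 then show ?case by simp
    next
      case (Suc n)
      have "cos (\<theta> + pi * real n / K - pi / (2 * real K)) - cos (\<theta> + pi * real (Suc n) / K - pi / (2 * real K))
          = 2 * sin (pi / (2 * real K)) * sin (\<theta> + pi * real n / K)"
      proof -
        have e: "\<theta> + pi * real (Suc n) / K - pi / (2 * real K) = (\<theta> + pi * real n / K) + pi / (2 * real K)"
          using K by (simp add: field_simps)
        show ?thesis unfolding e cos_diff cos_add by simp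
      qed
      then show ?case using Suc by (simp add: distrib_left)
    qed
    have "(\<Sum>j<K. \<bar>sin (\<theta> + pi * real j / K)\<bar>) = (\<Sum>j<K. sin (\<theta> + pi * real j / K))"
    proof (intro sum.cong refl abs_of_nonneg sin_ge_zero)
      fix j assume j: "j \<in> {..<K}"
      show "0 \<le> \<theta> + pi * real j / K" using \<theta> by simp
      have "\<theta> + pi * real j / K \<le> pi / K + pi * real j / K" using \<theta> by simp
      also have "\<dots> = pi * (real j + 1) / K" by (simp add: distrib_left add_divide_distrib)
      also have "\<dots> \<le> pi * real K / K"
        using j by (intro divide_right_mono mult_left_mono) auto
      finally show "\<theta> + pi * real j / K \<le> pi" using K by simp
    qed
    also have "2 * sin (pi / (2 * real K)) * \<dots> \<le> 2"
    proof -
      have "cos x - cos y \<le> 2" for x y :: real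
        using cos_le_one[of x] cos_ge_minus_one[of y] by linarith
      then show ?thesis unfolding tele .
    qed
    finally show ?thesis using s by (simp add: field_simps)
  qed
  \<comment> \<open>The number of steps pi / K that brings \<theta> into the first cell. It may be
    negative, whereas \<open>sum_abs_sin_shift\<close> counts steps by a natural number, so two
    directions of shift are distinguished below.\<close>
  define m where "m = \<lfloor>\<theta> * K / pi\<rfloor>"
  define \<theta>' where "\<theta>' = \<theta> - m * (pi / K)"
  have "real_of_int m \<le> \<theta> * K / pi" "\<theta> * K / pi \<le> real_of_int m + 1" unfolding m_def by linarith+
  then have "real_of_int m * pi \<le> \<theta> * K" "\<theta> * K \<le> real_of_int m * pi + pi"
    by (simp_all add: field_simps)
  moreover have "\<theta>' = (\<theta> * K - real_of_int m * pi) / K" using K by (simp add: \<theta>'_def diff_divide_distrib)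
  ultimately have "0 \<le> \<theta>'" "\<theta>' \<le> pi / K" by (auto intro!: divide_right_mono)
  from *[OF this] have "(\<Sum>j<K. \<bar>sin (\<theta>' + pi * real j / K)\<bar>) \<le> 1 / sin (pi / (2 * real K))" .
  moreover have "(\<Sum>j<K. \<bar>sin (\<theta>' + pi * real j / K)\<bar>) = (\<Sum>j<K. \<bar>sin (\<theta> + pi * real j / K)\<bar>)"
  proof (cases "m \<ge> 0")
    case True
    then have "\<theta> = \<theta>' + real (nat m) * (pi / K)" by (simp add: \<theta>'_def)
    then show ?thesis using sum_abs_sin_shift[OF K, of \<theta>' "nat m"] by simp
  next
    case False
    then have "\<theta>' = \<theta> + real (nat (-m)) * (pi / K)" by (simp add: \<theta>'_def)
    then show ?thesis using sum_abs_sin_shift[OF K, of \<theta> "nat (-m)"] by simp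
  qed
  ultimately show ?thesis by simp
qed

text \<open>Maximum modulus principle. Points with \<open>norm \<xi> = r\<close> are covered by the
  hypothesis itself, which includes the degenerate radius 0.\<close>

lemma norm_le_max_circle:
  assumes "H holomorphic_on UNIV" "\<And>s. norm s = r \<Longrightarrow> norm (H s) \<le> B" "norm \<xi> \<le> r"
  shows "norm (H \<xi>) \<le> (B::real)"
proof (cases "norm \<xi> = r")
  case True then show ?thesis using assms by auto
next
  case False
  then have r: "norm \<xi> < r" using assms by simp
  then have "0 < r" by (meson norm_ge_zero le_less_trans)
  show ?thesis
  proof (rule maximum_modulus_frontier[of H "cball 0 r"])
    show "H holomorphic_on interior (cball 0 r)" using assms(1) by (rule holomorphic_on_subset) auto
    show "continuous_on (closure (cball 0 r)) H"
      using assms(1) holomorphic_on_imp_continuous_on holomorphic_on_subset by blast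
    show "norm (H s) \<le> B" if "s \<in> frontier (cball 0 r)" for s
      using that assms(2) \<open>0 < r\<close> by (auto simp: frontier_cball)
  qed (use assms in auto)
qed

text \<open>
  Jensen's formula, with the mean over the circle replaced by a product over \<open>2 K\<close> rotations
  and the maximum principle. Replacing the factor \<open>s - l\<close> by \<open>r - l s / r\<close> for each
  zero \<open>l\<close> keeps the modulus on the circle \<open>|s| = r\<close> because the zeros are real.
\<close>

lemma discrete_Jensen:
  fixes \<Lambda> :: "real set" and h :: "complex \<Rightarrow> complex"
  assumes h: "h holomorphic_on UNIV" and fin: "finite \<Lambda>" and r: "r > 0"
    and \<Lambda>: "\<And>l. l \<in> \<Lambda> \<Longrightarrow> l \<noteq> 0" "\<And>l. l \<in> \<Lambda> \<Longrightarrow> h (of_real l) = 0"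
    and B: "\<And>s. norm s = r \<Longrightarrow> norm (h s) \<le> B * exp (a * \<bar>Im s\<bar>)"
    and a: "a \<ge> 0" and K: "K \<ge> (1::nat)"
  shows "norm (h 0) * (\<Prod>l\<in>\<Lambda>. r / \<bar>l\<bar>) \<le> B * exp (a * r / (K * sin (pi / (2 * real K))))"
proof -
  obtain g where g: "g holomorphic_on UNIV" "\<And>s. h s = g s * (\<Prod>l\<in>complex_of_real ` \<Lambda>. s - l)"
    using holomorphic_factor_zeros[of "complex_of_real ` \<Lambda>" h] fin h \<Lambda>(2) by auto
  have hg: "h s = g s * (\<Prod>l\<in>\<Lambda>. s - of_real l)" for s
    by (simp add: g(2) prod.reindex inj_on_def)
  define G where "G = (\<lambda>s. g s * (\<Prod>l\<in>\<Lambda>. of_real r - of_real l * s / of_real r))"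
  have G_hol: "G holomorphic_on UNIV"
    unfolding G_def using r by (intro holomorphic_intros g) auto
  have G_circle: "norm (G s) = norm (h s)" if s: "norm s = r" for s
  proof -
    have "norm (of_real r - of_real l * s / of_real r) = norm (s - of_real l)" for l
    proof -
      have "complex_of_real r * of_real r = s * cnj s"
        using s complex_norm_square[of s] by (simp add: power2_eq_square)
      then have "(of_real r - of_real l * s / of_real r) * of_real r = s * cnj (s - of_real l)"
        using r by (simp add: algebra_simps)
      then have "norm (of_real r - of_real l * s / of_real r) * r = r * norm (s - of_real l)"
        by (metis norm_mult complex_mod_cnj s norm_of_real abs_of_pos r)
      then show ?thesis using r by simp
    qed
    then show ?thesis unfolding G_def hg norm_mult prod_norm[symmetric] by simp
  qed
  have G0: "norm (G 0) = norm (h 0) * (\<Prod>l\<in>\<Lambda>. r / \<bar>l\<bar>)"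
  proof -
    have "norm (h 0) * (\<Prod>l\<in>\<Lambda>. r / \<bar>l\<bar>) = norm (g 0) * (\<Prod>l\<in>\<Lambda>. \<bar>l\<bar> * (r / \<bar>l\<bar>))"
      unfolding hg norm_mult prod_norm[symmetric] prod.distrib by simp
    also have "(\<Prod>l\<in>\<Lambda>. \<bar>l\<bar> * (r / \<bar>l\<bar>)) = (\<Prod>l\<in>\<Lambda>. r)"
      using \<Lambda>(1) by (intro prod.cong) auto
    finally show ?thesis
      using r by (simp add: G_def norm_mult norm_power)
  qed
  define S where "S = sin (pi / (2 * real K))"
  have S: "S > 0" unfolding S_def using K by (intro sin_gt_zero) (auto simp: field_simps)
  have B0: "B \<ge> 0"
  proof -
    have "0 \<le> B * exp (a * \<bar>Im (of_real r)\<bar>)" using B[of "of_real r"] r norm_ge_zero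
      by (metis abs_of_pos norm_of_real order_trans)
    then show ?thesis by (simp add: zero_le_mult_iff)
  qed
  \<comment> \<open>The factors are rotations of \<open>G\<close> through a full turn, so at 0 the
    product has modulus \<open>norm (G 0) ^ (2 * K)\<close>, while on the circle the growth
    exponents add up to a discrete mean.\<close>
  define H where "H = (\<lambda>s. \<Prod>j<2*K. G (cis (pi * real j / K) * s))"
  have H_hol: "H holomorphic_on UNIV"
    unfolding H_def
    by (intro holomorphic_on_prod holomorphic_on_compose_gen[OF _ G_hol, unfolded o_def])
       (auto intro!: holomorphic_intros)
  have H_circle: "norm (H s) \<le> (B * exp (a * r / (K * S))) ^ (2 * K)" if s: "norm s = r" for s
  proof -
    define \<theta> where "\<theta> = Arg s"
    have sr: "s = of_real r * cis \<theta>"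
      using rcis_cmod_Arg[of s] s by (simp add: \<theta>_def rcis_def)
    have "norm (H s) = (\<Prod>j<2*K. norm (h (cis (pi * real j / K) * s)))"
      unfolding H_def prod_norm[symmetric] by (intro prod.cong refl G_circle) (simp add: norm_mult s)
    also have "\<dots> \<le> (\<Prod>j<2*K. B * exp (a * r * \<bar>sin (\<theta> + pi * real j / K)\<bar>))"
    proof (intro prod_mono conjI norm_ge_zero)
      fix j
      have "Im (cis (pi * real j / K) * s) = r * sin (\<theta> + pi * real j / K)"
        by (simp add: sr sin_add algebra_simps)
      then have "\<bar>Im (cis (pi * real j / K) * s)\<bar> = r * \<bar>sin (\<theta> + pi * real j / K)\<bar>"
        using r by (simp add: abs_mult)
      then show "norm (h (cis (pi * real j / K) * s)) \<le> B * exp (a * r * \<bar>sin (\<theta> + pi * real j / K)\<bar>)"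
        using B[of "cis (pi * real j / K) * s"] s by (simp add: norm_mult mult.assoc)
    qed
    also have "\<dots> = B ^ (2 * K) * exp (a * r * (\<Sum>j<2*K. \<bar>sin (\<theta> + pi * real j / K)\<bar>))"
      by (simp add: prod.distrib exp_sum sum_distrib_left)
    \<comment> \<open>The second half turn repeats the first, by the period pi.\<close>
    also have "(\<Sum>j<2*K. \<bar>sin (\<theta> + pi * real j / K)\<bar>) = 2 * (\<Sum>j<K. \<bar>sin (\<theta> + pi * real j / K)\<bar>)"
    proof -
      have split: "(\<Sum>j<K+n. f j) = (\<Sum>j<K. f j) + (\<Sum>j<n. f (K + j))" for n and f :: "nat \<Rightarrow> real"
        by (induction n) simp_all
      have "(\<Sum>j<2*K. \<bar>sin (\<theta> + pi * real j / K)\<bar>) =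
        (\<Sum>j<K. \<bar>sin (\<theta> + pi * real j / K)\<bar>) + (\<Sum>j<K. \<bar>sin (\<theta> + pi * real (K + j) / K)\<bar>)"
        unfolding mult_2 by (rule split)
      moreover have "\<bar>sin (\<theta> + pi * real (K + j) / K)\<bar> = \<bar>sin (\<theta> + pi * real j / K)\<bar>" for j
      proof -
        have "\<theta> + pi * real (K + j) / K = (\<theta> + pi * real j / K) + pi" using K by (simp add: field_simps)
        then show ?thesis by (metis abs_minus_cancel sin_periodic_pi)
      qed
      ultimately show ?thesis by simp
    qed
    also have "B ^ (2 * K) * exp (a * r * (2 * (\<Sum>j<K. \<bar>sin (\<theta> + pi * real j / K)\<bar>)))
        \<le> B ^ (2 * K) * exp (a * r * (2 * (1 / S)))"
      unfolding S_def using a r B0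
      by (intro mult_left_mono sum_abs_sin_le K iffD2[OF exp_le_cancel_iff]) auto
    also have "\<dots> = (B * exp (a * r / (K * S))) ^ (2 * K)"
      using K S by (simp add: power_mult_distrib exp_of_nat_mult[symmetric] field_simps)
    finally show ?thesis .
  qed
  have "norm (H 0) \<le> (B * exp (a * r / (K * S))) ^ (2 * K)"
  proof (rule norm_le_max_circle[where r = r, OF H_hol])
    show "norm (0::complex) \<le> r" using r by simp
  qed (rule H_circle)
  moreover have "norm (H 0) = norm (G 0) ^ (2 * K)" unfolding H_def by (simp only: mult_zero_right prod_constant norm_power card_lessThan)
  ultimately have pow: "norm (G 0) ^ (2 * K) \<le> (B * exp (a * r / (K * S))) ^ (2 * K)"
    by (simp only:)
  have "norm (G 0) \<le> B * exp (a * r / (K * S))"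
  proof (rule power_mono_iff[THEN iffD1, OF _ _ _ pow])
    show "0 \<le> B * exp (a * r / (K * S))" using B0 by simp
  qed (use K in simp_all)
  then show ?thesis unfolding G0 S_def .
qed

section \<open>Growth and interpolation of polynomials\<close>

text \<open>Inside the disc this is the maximum principle. Outside, the maximum principle is applied
  to the reciprocal polynomial at the point \<open>inverse \<xi>\<close>; on the circle it has the
  same bound as \<open>q\<close>.\<close>

lemma norm_poly_le_max_circle:
  fixes q :: "complex poly"
  assumes M: "\<And>u. norm u = 1 \<Longrightarrow> norm (poly q u) \<le> M" and deg: "degree q \<le> N"
  shows "norm (poly q \<xi>) \<le> M * max 1 (norm \<xi>) ^ N"
proof (cases "norm \<xi> \<le> 1")
  case True
  have "norm (poly q \<xi>) \<le> M"
    by (rule norm_le_max_circle[of "poly q" 1, OF poly_holomorphic_on[OF holomorphic_on_ident] M True])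
  then show ?thesis using True by simp
next
  case False
  then have \<xi>: "norm \<xi> > 1" "\<xi> \<noteq> 0" by auto
  have M0: "M \<ge> 0" using M[of 1] norm_ge_zero[of "poly q 1"] by (simp del: norm_ge_zero)
  have "norm (poly (reflect_poly q) (inverse \<xi>)) \<le> M"
  proof (rule norm_le_max_circle[where r = 1 and H = "poly (reflect_poly q)"])
    fix s :: complex assume s: "norm s = 1"
    then have "s \<noteq> 0" by auto
    then have "norm (poly (reflect_poly q) s) = norm (poly q (inverse s))"
      by (simp add: poly_reflect_poly_nz norm_mult norm_power s)
    then show "norm (poly (reflect_poly q) s) \<le> M" using M[of "inverse s"] s by (simp add: norm_inverse)
  next
    show "norm (inverse \<xi>) \<le> 1" using \<xi> by (simp add: norm_inverse inverse_le_1_iff)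
  next
    show "poly (reflect_poly q) holomorphic_on UNIV"
      by (rule poly_holomorphic_on[OF holomorphic_on_ident])
  qed
  moreover have "poly (reflect_poly q) (inverse \<xi>) = inverse \<xi> ^ degree q * poly q \<xi>"
    using \<xi> by (subst poly_reflect_poly_nz) auto
  ultimately have "norm \<xi> ^ degree q * norm (inverse \<xi> ^ degree q * poly q \<xi>) \<le> norm \<xi> ^ degree q * M"
    by (intro mult_left_mono) simp_all
  moreover have "norm \<xi> ^ degree q * norm (inverse \<xi> ^ degree q * poly q \<xi>) = norm (poly q \<xi>)"
    unfolding norm_mult norm_power norm_inverse power_inverse using \<xi> by simp
  ultimately have "norm (poly q \<xi>) \<le> M * norm \<xi> ^ degree q" by (simp only: mult.commute)
  also have "\<dots> \<le> M * norm \<xi> ^ N" using \<xi> deg M0 by (intro mult_left_mono power_increasing) auto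
  finally show ?thesis using \<xi> by simp
qed

text \<open>In the Lagrange basis every factor (s - y) / (x - y) has modulus at most 2 r /
  \<epsilon>. This base is at least 1, so the exponent may be raised from \<open>card X - 1\<close>
  to \<open>card X\<close>.\<close>

lemma Lagrange_interpolation_bounded:
  fixes X :: "complex set"
  assumes fin: "finite X" and X: "\<And>x. x \<in> X \<Longrightarrow> norm x \<le> r" and \<epsilon>: "0 < \<epsilon>" "\<epsilon> \<le> 2 * r"
    and sep: "\<And>x y. x \<in> X \<Longrightarrow> y \<in> X \<Longrightarrow> x \<noteq> y \<Longrightarrow> \<epsilon> \<le> norm (x - y)"
    and v: "\<And>x. x \<in> X \<Longrightarrow> norm (v x) \<le> \<delta>"
  obtains P where "degree P \<le> card X - 1" "\<And>x. x \<in> X \<Longrightarrow> poly P x = v x"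
    "\<And>s. norm s \<le> r \<Longrightarrow> norm (poly P s) \<le> real (card X) * (2 * r / \<epsilon>) ^ card X * \<delta>"
proof
  define l where "l = (\<lambda>x. \<Prod>y\<in>X - {x}. smult (1 / (x - y)) [:-y, 1:])"
  define P where "P = (\<Sum>x\<in>X. smult (v x) (l x))"
  have poly_l: "poly (l x) s = (\<Prod>y\<in>X - {x}. (s - y) / (x - y))" for x s
    unfolding l_def poly_prod
    by (intro prod.cong) (simp_all add: diff_divide_distrib)
  show "degree P \<le> card X - 1"
    unfolding P_def
  proof (intro degree_sum_le fin)
    fix x assume x: "x \<in> X"
    have "degree (l x) \<le> (\<Sum>y\<in>X - {x}. degree (smult (1 / (x - y)) [:-y, 1:]))"
      unfolding l_def
      using degree_prod_sum_le[of "X - {x}" "\<lambda>y. smult (1 / (x - y)) [:-y, 1:]"] fin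
      by (simp only: o_def finite_Diff)
    also have "\<dots> \<le> (\<Sum>y\<in>X - {x}. 1)" by (intro sum_mono order.trans[OF degree_smult_le]) auto
    finally have "degree (l x) \<le> card X - 1" using x fin by simp
    then show "degree (smult (v x) (l x)) \<le> card X - 1" by (meson degree_smult_le order_trans)
  qed
  show "poly P x = v x" if x: "x \<in> X" for x
  proof -
    have "poly (l y) x = (if y = x then 1 else 0)" if y: "y \<in> X" for y
      using that x fin by (auto simp: poly_l)
    then have "poly P x = (\<Sum>y\<in>X. v y * (if y = x then 1 else 0))"
      unfolding P_def poly_sum by (intro sum.cong) auto
    also have "\<dots> = (\<Sum>y\<in>X. if y = x then v x else 0)" by (intro sum.cong) auto
    also have "\<dots> = v x" using fin x by simp
    finally show ?thesis .
  qed
  show "norm (poly P s) \<le> real (card X) * (2 * r / \<epsilon>) ^ card X * \<delta>" if s: "norm s \<le> r" for s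
  proof -
    have "norm (poly P s) \<le> (\<Sum>x\<in>X. norm (v x * poly (l x) s))"
      unfolding P_def poly_sum poly_smult by (rule norm_sum)
    also have "\<dots> \<le> (\<Sum>x\<in>X. \<delta> * (2 * r / \<epsilon>) ^ card X)"
    proof (intro sum_mono)
      fix x assume x: "x \<in> X"
      have "norm (poly (l x) s) = (\<Prod>y\<in>X - {x}. norm ((s - y) / (x - y)))"
        unfolding poly_l prod_norm[symmetric] ..
      also have "\<dots> \<le> (\<Prod>y\<in>X - {x}. 2 * r / \<epsilon>)"
      proof (intro prod_mono conjI norm_ge_zero)
        fix y assume y: "y \<in> X - {x}"
        have "norm (s - y) \<le> 2 * r" using s X[of y] y norm_triangle_ineq4[of s y] by auto
        then show "norm ((s - y) / (x - y)) \<le> 2 * r / \<epsilon>"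
          unfolding norm_divide using x y sep[of x y] \<epsilon> by (intro frac_le) auto
      qed
      also have "\<dots> = (2 * r / \<epsilon>) ^ card (X - {x})" by simp
      also have "\<dots> \<le> (2 * r / \<epsilon>) ^ card X"
        using \<epsilon> fin by (intro power_increasing card_mono) (auto simp: field_simps)
      finally show "norm (v x * poly (l x) s) \<le> \<delta> * (2 * r / \<epsilon>) ^ card X"
        unfolding norm_mult using v[OF x] by (intro mult_mono) (auto intro: order.trans[OF norm_ge_zero])
    qed
    finally show ?thesis by (simp add: mult_ac)
  qed
qed

section \<open>Sampling in the maximum norm\<close>

text \<open>A weak Stirling bound: it yields L^L / L! \<ge> e^(L - 1) / L. The induction step rests
  on (1 - 1 / (L + 1))^(L + 1) \<le> 1 / e.\<close>

lemma exp_times_fact_le: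
  assumes "L \<ge> 1"
  shows "exp (real L - 1) * fact L \<le> real L ^ (L + 1)"
  using assms
proof (induction L rule: dec_induct)
  case base then show ?case by simp
next
  case (step L)
  then have L: "L \<ge> 1" by simp
  have "(real L / (real L + 1)) ^ (L + 1) \<le> exp (- (1 / (real L + 1))) ^ (L + 1)"
  proof (rule power_mono)
    have "1 + - (1 / (real L + 1)) \<le> exp (- (1 / (real L + 1)))" by (rule exp_ge_add_one_self)
    moreover have "1 + - (1 / (real L + 1)) = real L / (real L + 1)" by (simp add: field_simps)
    ultimately show "real L / (real L + 1) \<le> exp (- (1 / (real L + 1)))" by simp
  qed simp
  also have "\<dots> = exp (- 1)"
    by (simp only: exp_of_nat_mult[symmetric]) (simp add: field_simps)
  finally have "real L ^ (L + 1) / (real L + 1) ^ (L + 1) \<le> exp (- 1)" by (simp only: power_divide)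
  then have "real L ^ (L + 1) \<le> exp (- 1) * (real L + 1) ^ (L + 1)"
    by (subst (asm) pos_divide_le_eq) (auto intro!: zero_less_power)
  then have "exp 1 * real L ^ (L + 1) \<le> exp 1 * (exp (- 1) * (real L + 1) ^ (L + 1))"
    by (intro mult_left_mono) auto
  also have "\<dots> = (real L + 1) ^ (L + 1)" by (simp add: exp_minus)
  finally have key: "exp 1 * real L ^ (L + 1) \<le> (real L + 1) ^ (L + 1)" .
  have "exp (real (Suc L) - 1) * fact (Suc L) = exp 1 * (real L + 1) * (exp (real L - 1) * fact L)"
    by (simp add: exp_add[symmetric] algebra_simps)
  also have "\<dots> \<le> exp 1 * (real L + 1) * real L ^ (L + 1)"
    using step.IH by (intro mult_left_mono) auto
  also have "\<dots> = (real L + 1) * (exp 1 * real L ^ (L + 1))" by (simp only: mult_ac)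
  also have "\<dots> \<le> (real L + 1) * (real L + 1) ^ (L + 1)"
    using key by (intro mult_left_mono) auto
  finally show ?case by (simp add: add.commute)
qed

text \<open>
  With \<open>c\<close> zeros in each interval of length \<open>R\<close> up to distance \<open>L R\<close>, Jensen's formula gains
  \<open>(L\<^sup>L / L!)\<^bsup>2c\<^esup>\<close>, about \<open>e\<^bsup>2cL\<^esup>\<close>, and loses about \<open>e\<^bsup>(1 + e) L R / \<pi>\<^esup>\<close>.
\<close>

lemma Jensen_constants:
  fixes R :: real and c :: nat
  assumes R: "R > 0" and c: "real c > R / (2 * pi)"
  obtains e :: real and K L :: nat where "e > 0" "K \<ge> 1" "L \<ge> 1"
    "2 * exp ((1 + e) / 2 * (real L * R) / (real K * sin (pi / (2 * real K)))) \<le> (real L ^ L / fact L) ^ (2 * c)"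
proof -
  have "c > 0" using R c by (metis divide_nonneg_nonneg less_imp_le mult_nonneg_nonneg not_gr0 of_nat_0
        not_le pi_ge_zero zero_le_numeral)
  \<comment> \<open>The denominator in Jensen's formula. It tends to pi / 2, and the assumption on
    \<open>c\<close> says exactly that R / (4 c) lies below this limit, so some finite
    \<open>K\<close> suffices.\<close>
  define \<kappa> where "\<kappa> = (\<lambda>K::nat. real K * sin (pi / (2 * real K)))"
  have "((\<lambda>h. (sin (0 + h) - sin 0) / h) \<longlongrightarrow> cos (0::real)) (at 0)"
    using DERIV_sin[of "0::real"] by (simp only: DERIV_def)
  then have "((\<lambda>h. sin h / h) \<longlongrightarrow> (1::real)) (at 0)" by simp
  moreover have "filterlim (\<lambda>K. pi / (2 * real K)) (at 0) sequentially"
  proof (rule filterlim_atI)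
    have "(\<lambda>K. (pi / 2) * (1 / real K)) \<longlonglongrightarrow> (pi / 2) * 0"
      by (intro tendsto_mult tendsto_const lim_1_over_n)
    then show "(\<lambda>K. pi / (2 * real K)) \<longlonglongrightarrow> 0" by simp
    show "\<forall>\<^sub>F K in sequentially. pi / (2 * real K) \<noteq> 0"
      using eventually_gt_at_top[of 0] by eventually_elim simp
  qed
  ultimately have "(\<lambda>K. sin (pi / (2 * real K)) / (pi / (2 * real K))) \<longlonglongrightarrow> 1"
    by (rule filterlim_compose)
  then have "(\<lambda>K. (pi / 2) * (sin (pi / (2 * real K)) / (pi / (2 * real K)))) \<longlonglongrightarrow> (pi / 2) * 1"
    by (intro tendsto_mult tendsto_const)
  moreover have "\<forall>\<^sub>F K in sequentially. (pi / 2) * (sin (pi / (2 * real K)) / (pi / (2 * real K))) = \<kappa> K"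
    using eventually_gt_at_top[of 0] by eventually_elim (simp add: \<kappa>_def)
  ultimately have "\<kappa> \<longlonglongrightarrow> (pi / 2) * 1" by (rule Lim_transform_eventually)
  moreover have "R / (4 * real c) < (pi / 2) * 1" using c \<open>c > 0\<close> by (simp add: field_simps)
  ultimately have "\<forall>\<^sub>F K in sequentially. R / (4 * real c) < \<kappa> K" by (rule order_tendstoD(1))
  then have "\<forall>\<^sub>F K in sequentially. R / (4 * real c) < \<kappa> K \<and> K \<ge> 1"
    using eventually_ge_at_top by (rule eventually_conj)
  from eventually_happens'[OF sequentially_bot this]
  obtain K where K: "\<kappa> K > R / (4 * real c)" "K \<ge> 1" by blast
  \<comment> \<open>Without spare degree the loss is exp (b0 L), and the choice of \<open>K\<close>
    makes \<open>b0\<close> smaller than the rate 2 c of the gain.\<close>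
  define b0 where "b0 = R / (2 * \<kappa> K)"
  have \<kappa>: "\<kappa> K > 0" using K(1) R by (meson divide_nonneg_nonneg less_imp_le mult_nonneg_nonneg
        of_nat_0_le_iff order_le_less_trans zero_le_numeral)
  have b0: "b0 > 0" "b0 < 2 * real c"
    using \<kappa> R K(1) \<open>c > 0\<close> by (simp_all add: b0_def field_simps)
  \<comment> \<open>Chosen so that \<open>b = (1 + e) * b0\<close> is the midpoint between
    \<open>b0\<close> and 2 c.\<close>
  define e where "e = (2 * real c - b0) / (2 * b0)"
  have e: "e > 0" using b0 by (simp add: e_def)
  define b where "b = (1 + e) * b0"
  have b: "b < 2 * real c" using b0 by (simp add: b_def e_def field_simps)
  \<comment> \<open>The deficits of the gain, from the weak Stirling bound and from the factor 2 in
    the claim, divided by \<open>L\<close>: they vanish in the limit and thus fall below the gap 2 c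
    - b.\<close>
  have "(\<lambda>L. 2 * real c * (1 / real L + ln (real L) / real L) + ln 2 * (1 / real L)) \<longlonglongrightarrow> 2 * real c * (0 + 0) + ln 2 * 0"
    by (intro tendsto_intros lim_1_over_n lim_ln_over_n)
  moreover have "2 * real c * (0 + 0) + ln 2 * 0 < 2 * real c - b" using b by simp
  ultimately have "\<forall>\<^sub>F L in sequentially.
      2 * real c * (1 / real L + ln (real L) / real L) + ln 2 * (1 / real L) < 2 * real c - b"
    by (rule order_tendstoD(2))
  then have "\<forall>\<^sub>F L in sequentially.
      2 * real c * (1 / real L + ln (real L) / real L) + ln 2 * (1 / real L) < 2 * real c - b \<and> L \<ge> 1"
    using eventually_ge_at_top by (rule eventually_conj)
  from eventually_happens'[OF sequentially_bot this] obtain L where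
    L: "2 * real c * (1 / real L + ln (real L) / real L) + ln 2 * (1 / real L) < 2 * real c - b" "L \<ge> 1"
    by blast
  have "(2 * real c * (1 / real L + ln (real L) / real L) + ln 2 * (1 / real L)) * real L \<le> (2 * real c - b) * real L"
    using L by (intro mult_right_mono) auto
  moreover have "(2 * real c * (1 / real L + ln (real L) / real L) + ln 2 * (1 / real L)) * real L
      = 2 * real c * (1 + ln (real L)) + ln 2"
    using L(2) by (simp add: field_simps)
  ultimately have "ln 2 + b * real L \<le> real (2 * c) * (real L - 1 - ln (real L))"
    by (simp add: algebra_simps)
  then have "exp (ln 2 + b * real L) \<le> exp (real (2 * c) * (real L - 1 - ln (real L)))" by simp
  also have "\<dots> = (exp (real L - 1) / real L) ^ (2 * c)"
    using L(2) by (simp only: exp_of_nat_mult) (simp add: exp_diff)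
  also have "\<dots> \<le> (real L ^ L / fact L) ^ (2 * c)"
    using exp_times_fact_le[OF L(2)] L(2) by (intro power_mono) (simp_all add: field_simps)
  finally have "2 * exp (b * real L) \<le> (real L ^ L / fact L) ^ (2 * c)" by (simp add: exp_add)
  moreover have "b * real L = (1 + e) / 2 * (real L * R) / (real K * sin (pi / (2 * real K)))"
    by (simp add: b_def b0_def \<kappa>_def)
  ultimately show ?thesis using that[OF e K(2) L(2)] by simp
qed

text \<open>Subtracting the interpolant \<open>P\<close> of the node values makes \<open>f\<close>
  vanish at 2 L c real points of modulus at most L R, at the cost of C \<delta> in size. Jensen's
  formula and \<open>const\<close> then bound the difference at 0 by (M + C \<delta>) / 2. The
  factor 1/2 is what allows absorbing M later.\<close>

lemma sampling_at_0:
  fixes f :: "complex \<Rightarrow> complex" and A :: "int \<Rightarrow> real set"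
  assumes f: "f holomorphic_on UNIV" "\<And>s. norm (f s) \<le> M * exp (a * \<bar>Im s\<bar>)"
    and a: "a \<ge> 0" and R: "R > 0" and L: "L \<ge> (1::nat)" and K: "K \<ge> (1::nat)" and \<epsilon>: "\<epsilon> > 0" "\<epsilon> \<le> R"
    and A: "\<And>i. finite (A i)" "\<And>i. card (A i) = c" "\<And>i. A i \<subseteq> {of_int i * R<..<(of_int i + 1) * R}"
    and sep: "\<And>i j x y. x \<in> A i \<Longrightarrow> y \<in> A j \<Longrightarrow> x \<noteq> y \<Longrightarrow> \<epsilon> \<le> \<bar>x - y\<bar>"
    and \<delta>: "\<And>i x. x \<in> A i \<Longrightarrow> norm (f (of_real x)) \<le> \<delta>" "\<delta> \<ge> 0"
    and const: "2 * exp (a * (real L * R) / (real K * sin (pi / (2 * real K)))) \<le> (real L ^ L / fact L) ^ (2 * c)"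
  defines "C \<equiv> real (2 * L * c) * (2 * (real L * R) / \<epsilon>) ^ (2 * L * c)"
  shows "norm (f 0) \<le> C * \<delta> + (M + C * \<delta>) / 2"
proof -
  define r where "r = real L * R"
  have r: "r > 0" using L R by (simp add: r_def)
  define I where "I = {- int L..<int L}"
  define \<Lambda> where "\<Lambda> = (\<Union>i\<in>I. A i)"
  \<comment> \<open>\<open>\<mu> i * R\<close> is the distance from 0 to the far end of the i-th
    window. Windows i and -i - 1 share this distance, so the product over both sides of 0 is the
    square of a factorial.\<close>
  define \<mu> :: "int \<Rightarrow> real" where "\<mu> = (\<lambda>i. if i \<ge> 0 then of_int i + 1 else - of_int i)"
  have finI: "finite I" "card I = 2 * L" by (auto simp: I_def)
  have disj: "A i \<inter> A j = {}" if "i \<noteq> j" for i j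
  proof -
    have "x \<notin> A j" if "x \<in> A i" "i < j" for x i j
    proof
      assume "x \<in> A j"
      then have "of_int j * R < (of_int i + 1) * R" using A(3)[of i] A(3)[of j] that by force
      then have "real_of_int j < of_int i + 1" using R by simp
      then show False using that by linarith
    qed
    then show ?thesis using that by (metis disjoint_iff linorder_neqE)
  qed
  have fin\<Lambda>: "finite \<Lambda>" using finI A(1) by (simp add: \<Lambda>_def)
  have card\<Lambda>: "card \<Lambda> = 2 * L * c"
    unfolding \<Lambda>_def using finI A disj by (subst card_UN_disjoint) auto
  have \<mu>: "0 < \<bar>x\<bar>" "\<bar>x\<bar> \<le> \<mu> i * R" if "x \<in> A i" for x i
  proof -
    have x: "of_int i * R < x" "x < (of_int i + 1) * R" using A(3)[of i] that by auto
    have "0 < \<bar>x\<bar> \<and> \<bar>x\<bar> \<le> \<mu> i * R"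
    proof (cases "i \<ge> 0")
      case True
      then have "0 \<le> of_int i * R" using R by simp
      then show ?thesis using x True by (simp add: \<mu>_def)
    next
      case False
      then have "(of_int i + 1) * R \<le> 0" using R by (intro mult_nonpos_nonneg) auto
      then show ?thesis using x False by (simp add: \<mu>_def)
    qed
    then show "0 < \<bar>x\<bar>" "\<bar>x\<bar> \<le> \<mu> i * R" by auto
  qed
  have \<mu>_pos: "\<mu> i > 0" for i by (auto simp: \<mu>_def)
  have \<mu>_le: "\<mu> i \<le> real L" if "i \<in> I" for i using that by (auto simp: \<mu>_def I_def)
  have prod\<mu>: "(\<Prod>i\<in>{- int n..<int n}. \<mu> i) = (fact n)\<^sup>2" for n
  proof (induction n)
    case 0 then show ?case by simp
  next
    case (Suc n)
    have "{- int (Suc n)..<int (Suc n)} = insert (- int (Suc n)) (insert (int n) {- int n..<int n})" by auto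
    then have "(\<Prod>i\<in>{- int (Suc n)..<int (Suc n)}. \<mu> i) = \<mu> (- int (Suc n)) * (\<mu> (int n) * (fact n)\<^sup>2)"
      using Suc by simp
    then show ?case by (simp add: \<mu>_def power2_eq_square algebra_simps)
  qed
  have prod_ge: "(real L ^ L / fact L) ^ (2 * c) \<le> (\<Prod>l\<in>\<Lambda>. r / \<bar>l\<bar>)"
  proof -
    have "(real L ^ L / fact L) ^ (2 * c) = (\<Prod>i\<in>I. (real L / \<mu> i) ^ c)"
    proof -
      have "(\<Prod>i\<in>I. real L / \<mu> i) = (real L ^ L / fact L)\<^sup>2"
        using finI by (simp add: prod_dividef prod\<mu> I_def[symmetric] power_divide power_mult[symmetric] mult.commute)
           (simp add: I_def prod\<mu>)
      then show ?thesis by (simp add: prod_power_distrib[symmetric] power_mult)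
    qed
    also have "\<dots> \<le> (\<Prod>i\<in>I. \<Prod>l\<in>A i. r / \<bar>l\<bar>)"
    proof (intro prod_mono conjI)
      fix i assume "i \<in> I"
      show "0 \<le> (real L / \<mu> i) ^ c" using \<mu>_pos[of i] by simp
      have "(real L / \<mu> i) ^ c = (\<Prod>l\<in>A i. real L / \<mu> i)" by (simp add: A(2))
      also have "\<dots> \<le> (\<Prod>l\<in>A i. r / \<bar>l\<bar>)"
      proof (intro prod_mono conjI)
        fix x assume x: "x \<in> A i"
        show "0 \<le> real L / \<mu> i" using \<mu>_pos[of i] by simp
        have "real L / \<mu> i = r / (\<mu> i * R)" using R by (simp add: r_def)
        also have "\<dots> \<le> r / \<bar>x\<bar>" using \<mu>[OF x] r by (intro divide_left_mono) auto
        finally show "real L / \<mu> i \<le> r / \<bar>x\<bar>" .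
      qed
      finally show "(real L / \<mu> i) ^ c \<le> (\<Prod>l\<in>A i. r / \<bar>l\<bar>)" .
    qed
    also have "\<dots> = (\<Prod>l\<in>\<Lambda>. r / \<bar>l\<bar>)"
      unfolding \<Lambda>_def using finI A disj by (subst prod.UNION_disjoint) auto
    finally show ?thesis .
  qed
  have X1: "norm x \<le> r" if x: "x \<in> complex_of_real ` \<Lambda>" for x
  proof -
    obtain i y where y: "i \<in> I" "y \<in> A i" "x = of_real y" using x by (auto simp: \<Lambda>_def)
    have "\<bar>y\<bar> \<le> \<mu> i * R" using \<mu> y by blast
    also have "\<dots> \<le> r" unfolding r_def using \<mu>_le y(1) R by (intro mult_right_mono) auto
    finally show ?thesis using y by simp
  qed
  have X2: "\<epsilon> \<le> 2 * r"
  proof -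
    have "1 * R \<le> real L * R" using L R by (intro mult_right_mono) auto
    then show ?thesis using \<epsilon> R unfolding r_def by linarith
  qed
  have X3: "\<epsilon> \<le> norm (x - y)" if "x \<in> complex_of_real ` \<Lambda>" "y \<in> complex_of_real ` \<Lambda>" "x \<noteq> y" for x y
    using that sep by (auto simp: \<Lambda>_def of_real_diff[symmetric] simp del: of_real_diff)
  have X4: "norm (f x) \<le> \<delta>" if "x \<in> complex_of_real ` \<Lambda>" for x
    using that \<delta> by (auto simp: \<Lambda>_def)
  have "card (complex_of_real ` \<Lambda>) = 2 * L * c"
    by (simp add: card_image inj_on_def card\<Lambda>)
  then have C: "real (card (complex_of_real ` \<Lambda>)) * (2 * r / \<epsilon>) ^ card (complex_of_real ` \<Lambda>) = C"
    by (simp add: C_def r_def)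
  obtain P where P: "\<And>x. x \<in> complex_of_real ` \<Lambda> \<Longrightarrow> poly P x = f x"
    "\<And>s. norm s \<le> r \<Longrightarrow> norm (poly P s) \<le> C * \<delta>"
  proof (rule Lagrange_interpolation_bounded[of "complex_of_real ` \<Lambda>" r \<epsilon> f \<delta>, unfolded C])
    show "finite (complex_of_real ` \<Lambda>)" using fin\<Lambda> by simp
  qed (rule X1 X2 X3 X4 \<epsilon>(1) that; assumption)+
  have C\<delta>: "C * \<delta> \<ge> 0" using \<delta>(2) R \<epsilon> by (simp add: C_def)
  let ?h = "\<lambda>s. f s - poly P s"
  let ?E = "exp (a * r / (real K * sin (pi / (2 * real K))))"
  have "norm (?h 0) * (\<Prod>l\<in>\<Lambda>. r / \<bar>l\<bar>) \<le> (M + C * \<delta>) * ?E"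
  proof (rule discrete_Jensen[OF _ fin\<Lambda> r _ _ _ a K])
    show "?h holomorphic_on UNIV"
      by (intro holomorphic_on_diff f(1) poly_holomorphic_on[OF holomorphic_on_ident])
    show "l \<noteq> 0" if "l \<in> \<Lambda>" for l using that \<mu> by (auto simp: \<Lambda>_def)
    show "?h (of_real l) = 0" if "l \<in> \<Lambda>" for l using that P(1) by simp
    show "norm (?h s) \<le> (M + C * \<delta>) * exp (a * \<bar>Im s\<bar>)" if "norm s = r" for s
    proof -
      have "norm (?h s) \<le> norm (f s) + norm (poly P s)" by (rule norm_triangle_ineq4)
      also have "\<dots> \<le> M * exp (a * \<bar>Im s\<bar>) + C * \<delta> * 1" using f(2) P(2) that by (intro add_mono) auto
      \<comment> \<open>The bound on the interpolant is inflated by an exponential that is at least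
        1, to fit the growth condition of \<open>discrete_Jensen\<close>.\<close>
      also have "\<dots> \<le> M * exp (a * \<bar>Im s\<bar>) + C * \<delta> * exp (a * \<bar>Im s\<bar>)"
        using a C\<delta> by (intro add_left_mono mult_left_mono) auto
      finally show ?thesis by (simp add: algebra_simps)
    qed
  qed
  moreover have "norm (?h 0) * (2 * ?E) \<le> norm (?h 0) * (\<Prod>l\<in>\<Lambda>. r / \<bar>l\<bar>)"
    using const prod_ge unfolding r_def[symmetric] by (intro mult_left_mono) auto
  ultimately have "(norm (?h 0) * 2) * ?E \<le> (M + C * \<delta>) * ?E" by (simp only: mult.assoc)
  then have "norm (?h 0) * 2 \<le> M + C * \<delta>" by (simp only: mult_le_cancel_right_pos exp_gt_zero)
  moreover have "norm (f 0) \<le> norm (?h 0) + norm (poly P 0)"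
    using norm_triangle_ineq[of "?h 0" "poly P 0"] by simp
  moreover have "norm (poly P 0) \<le> C * \<delta>" using P(2)[of 0] r by simp
  moreover have "u \<le> d + (M + d) / 2" if "v * 2 \<le> M + d" "u \<le> v + t" "t \<le> d" for u v t d :: real
    using that by (simp add: field_simps)
  ultimately show ?thesis by blast
qed

text \<open>Rescaling is centred at a point \<open>u\<close> where the modulus of \<open>q\<close>
  attains its maximum M on the circle, so \<open>f 0\<close> has modulus M. Then M \<le> C \<delta>
  + (M + C \<delta>) / 2, which gives M \<le> 3 C \<delta>.\<close>

lemma poly_sampling:
  fixes q :: "complex poly" and Z :: "complex set"
  assumes n: "n \<ge> (1::nat)" and Z: "finite Z" and \<epsilon>: "\<epsilon> > 0" "\<epsilon> \<le> R" "\<epsilon> \<le> 1"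
    and sep: "\<And>u v. u \<in> Z \<Longrightarrow> v \<in> Z \<Longrightarrow> u \<noteq> v \<Longrightarrow> \<epsilon> / real n \<le> norm (u - v)"
    and arcs: "\<And>x. c \<le> card (Z \<inter> open_arc x (x + R / real n))"
    and L: "L \<ge> (1::nat)" and K: "K \<ge> (1::nat)" and e: "e \<ge> 0"
    and const: "2 * exp ((1 + e) / 2 * (real L * R) / (real K * sin (pi / (2 * real K)))) \<le> (real L ^ L / fact L) ^ (2 * c)"
    and deg: "real (degree q) \<le> (1 + e) * real n"
    and \<delta>: "\<And>u. u \<in> Z \<Longrightarrow> norm (poly q u) \<le> \<delta>" "\<delta> \<ge> 0" and w: "norm w = 1"
  shows "norm (poly q w) \<le> 3 * (real (2 * L * c) * (2 * (real L * R) / \<epsilon>) ^ (2 * L * c)) * \<delta>"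
proof -
  define N where "N = real (degree q)"
  define C where "C = real (2 * L * c) * (2 * (real L * R) / \<epsilon>) ^ (2 * L * c)"
  have "\<exists>u\<in>sphere (0::complex) 1. \<forall>v\<in>sphere 0 1. norm (poly q v) \<le> norm (poly q u)"
    by (intro continuous_attains_sup) (auto intro!: continuous_intros)
  then obtain u where u: "norm u = 1" and umax: "\<And>v. norm v = 1 \<Longrightarrow> norm (poly q v) \<le> norm (poly q u)"
    by auto
  define M where "M = norm (poly q u)"
  define x where "x = Arg u"
  have ux: "u = cis x" using rcis_cmod_Arg[of u] u by (simp add: x_def rcis_def)
  \<comment> \<open>The polynomial alone stays bounded in the upper half plane and may grow with
    exponent N / n in the lower one. The exponential factor, unimodular on the real line, splits
    this evenly into exponent N / (2 n) on both sides.\<close>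
  define f where "f = (\<lambda>s. poly q (u * exp (\<i> * s / of_nat n)) * exp (- \<i> * of_real N * s / (2 * of_nat n)))"
  have f_hol: "f holomorphic_on UNIV"
    unfolding f_def using n by (intro holomorphic_intros poly_holomorphic_on) auto
  have f_growth: "norm (f s) \<le> M * exp ((1 + e) / 2 * \<bar>Im s\<bar>)" for s
  proof -
    define y where "y = Im s / real n"
    have nr: "norm (u * exp (\<i> * s / of_nat n)) = exp (- y)"
      by (simp add: norm_mult u y_def)
    have ex: "norm (exp (- \<i> * of_real N * s / (2 * of_nat n))) = exp (N * y / 2)"
    proof -
      have "- \<i> * of_real N * s / (2 * of_nat n) = of_real (N / (2 * real n)) * (- \<i> * s)" by simp
      moreover have "Re (of_real k * (- \<i> * s)) = k * Im s" for k by simp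
      ultimately have "Re (- \<i> * of_real N * s / (2 * of_nat n)) = N / (2 * real n) * Im s" by metis
      then show ?thesis by (simp add: y_def)
    qed
    have "norm (poly q (u * exp (\<i> * s / of_nat n))) \<le> M * max 1 (exp (- y)) ^ degree q"
      using norm_poly_le_max_circle[of q M "degree q" "u * exp (\<i> * s / of_nat n)"] umax
      unfolding nr M_def by simp
    also have "max 1 (exp (- y)) = exp (max 0 (- y))" by (simp add: max_def)
    also have "exp (max 0 (- y)) ^ degree q = exp (N * max 0 (- y))"
      by (simp add: N_def exp_of_nat_mult)
    finally have "norm (f s) \<le> M * exp (N * max 0 (- y)) * exp (N * y / 2)"
      unfolding f_def norm_mult ex by (intro mult_right_mono) auto
    also have "\<dots> = M * exp (N * \<bar>y\<bar> / 2)"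
      by (simp add: exp_add[symmetric] max_def field_simps)
    also have "\<dots> \<le> M * exp ((1 + e) / 2 * \<bar>Im s\<bar>)"
    proof -
      have "N * \<bar>y\<bar> \<le> ((1 + e) * real n) * \<bar>y\<bar>" using deg by (intro mult_right_mono) (auto simp: N_def)
      also have "\<dots> = (1 + e) * \<bar>Im s\<bar>" using n by (simp add: y_def)
      finally show ?thesis by (intro mult_left_mono) (auto simp: M_def)
    qed
    finally show ?thesis .
  qed
  define \<phi> where "\<phi> = (\<lambda>s. cis (x + s / real n))"
  have f\<phi>: "norm (f (of_real s)) = norm (poly q (\<phi> s))" for s
  proof -
    have "u * exp (\<i> * of_real s / of_nat n) = \<phi> s"
      by (simp add: \<phi>_def ux cis_conv_exp exp_add[symmetric] distrib_left)
    moreover have "norm (exp (- \<i> * of_real N * of_real s / (2 * of_nat n))) = 1" by simp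
    ultimately show ?thesis by (simp only: f_def norm_mult mult_1_right)
  qed
  \<comment> \<open>The i-th window corresponds to an arc of length R / n. Exactly \<open>c\<close>
    of its nodes are kept, each with one preimage on the line.\<close>
  have "\<exists>T. finite T \<and> card T = c \<and> T \<subseteq> {of_int i * R<..<(of_int i + 1) * R} \<and> \<phi> ` T \<subseteq> Z" for i :: int
  proof -
    define S where "S = {s. of_int i * R < s \<and> s < (of_int i + 1) * R \<and> \<phi> s \<in> Z}"
    define x' where "x' = x + of_int i * R / real n"
    have "Z \<inter> open_arc x' (x' + R / real n) \<subseteq> \<phi> ` S"
    proof
      fix v assume v: "v \<in> Z \<inter> open_arc x' (x' + R / real n)"
      then obtain t where t: "x' < t" "t < x' + R / real n" "v = cis t" by (auto simp: open_arc_def)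
      define s where "s = (t - x) * real n"
      have "t = x + s / real n" using n by (simp add: s_def)
      then have "v = \<phi> s" using t by (simp add: \<phi>_def)
      moreover have "of_int i * R < s" "s < (of_int i + 1) * R"
        using t n by (simp_all add: x'_def s_def field_simps)
      ultimately show "v \<in> \<phi> ` S" using v by (auto simp: S_def)
    qed
    then have "card (Z \<inter> open_arc x' (x' + R / real n)) \<le> card (\<phi> ` S)"
      by (intro card_mono finite_subset[OF _ Z]) (auto simp: S_def)
    then have "c \<le> card (\<phi> ` S)" using arcs[of x'] by linarith
    then obtain B where B: "B \<subseteq> \<phi> ` S" "card B = c" "finite B"
      using obtain_subset_with_card_n by metis
    then obtain T where T: "T \<subseteq> S" "inj_on \<phi> T" "B = \<phi> ` T" by (meson subset_image_inj)
    then have "finite T" "card T = c" using B by (auto simp: card_image dest: finite_imageD)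
    then show ?thesis using T by (intro exI[of _ T]) (auto simp: S_def)
  qed
  then obtain A where A: "\<And>i. finite (A i)" "\<And>i. card (A i) = c"
    "\<And>i::int. A i \<subseteq> {of_int i * R<..<(of_int i + 1) * R}" "\<And>i. \<phi> ` A i \<subseteq> Z" by metis
  have "norm (f 0) \<le> C * \<delta> + (M + C * \<delta>) / 2"
    unfolding C_def
  proof (rule sampling_at_0[OF f_hol f_growth _ _ L K \<epsilon>(1,2) A(1,2,3) _ _ \<delta>(2) const])
    fix i j s t assume st: "s \<in> A i" "t \<in> A j" "s \<noteq> t"
    \<comment> \<open>Long windows may wrap around the circle, so distinct reals can represent the
      same node. They then differ by a nonzero multiple of 2 pi n, which is at least 1 and hence at
      least \<epsilon>.\<close>
    show "\<epsilon> \<le> \<bar>s - t\<bar>"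
    proof (cases "\<phi> s = \<phi> t")
      case True
      then have "sin (x + s / real n) = sin (x + t / real n) \<and> cos (x + s / real n) = cos (x + t / real n)"
        unfolding \<phi>_def by (simp add: complex_eq_iff)
      then obtain k :: int where "x + s / real n = x + t / real n + 2 * pi * k"
        unfolding sin_cos_eq_iff by blast
      then have k: "s - t = 2 * pi * real n * k" using n by (simp add: field_simps)
      then have "k \<noteq> 0" using st by auto
      then have "1 \<le> \<bar>real_of_int k\<bar>" by linarith
      moreover have "1 * 1 \<le> 2 * pi * real n" using n pi_gt3 by (intro mult_mono) auto
      ultimately have "1 * 1 \<le> 2 * pi * real n * \<bar>real_of_int k\<bar>" by (intro mult_mono) auto
      then show ?thesis using \<epsilon>(3) unfolding k by (simp add: abs_mult)
    next
      case False
      then have "\<epsilon> / real n \<le> norm (\<phi> s - \<phi> t)" using A(4) st by (intro sep) auto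
      also have "\<dots> \<le> \<bar>(x + s / real n) - (x + t / real n)\<bar>" unfolding \<phi>_def by (rule chord_le)
      also have "\<dots> = \<bar>s - t\<bar> / real n" by (simp add: diff_divide_distrib[symmetric])
      finally show ?thesis using n by (simp add: divide_le_cancel)
    qed
  next
    show "norm (f (of_real s)) \<le> \<delta>" if "s \<in> A i" for i s
      unfolding f\<phi> using A(4) that by (intro \<delta>(1)) auto
  qed (use e \<epsilon> in auto)
  moreover have "norm (f 0) = M" by (simp add: f_def M_def)
  ultimately have "M \<le> 3 * C * \<delta>" by (simp add: field_simps)
  then show ?thesis using umax[OF w] unfolding M_def C_def by linarith
qed

section \<open>Dense families\<close>

lemma open_arc_shift: "open_arc (x + 2 * pi * of_int k) (y + 2 * pi * of_int k) = open_arc x y"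
proof -
  have "cis (t + 2 * pi * of_int k) = cis t" for t
    by (simp add: cis_mult[symmetric] cis_multiple_2pi)
  moreover have "{x + 2 * pi * of_int k<..<y + 2 * pi * of_int k} = (\<lambda>t. t + 2 * pi * of_int k) ` {x<..<y}" for k
  proof (intro equalityI subsetI)
    fix s assume "s \<in> {x + 2 * pi * of_int k<..<y + 2 * pi * of_int k}"
    then show "s \<in> (\<lambda>t. t + 2 * pi * of_int k) ` {x<..<y}"
      by (intro image_eqI[of _ _ "s - 2 * pi * of_int k"]) auto
  qed auto
  ultimately show ?thesis unfolding open_arc_def by (simp only: image_image)
qed

text \<open>By periodicity an arbitrary starting angle may be reduced to [0, 2 pi], where the
  minimum is taken.\<close>

lemma min_arc_count_le:
  "min_arc_count m z n r \<le> card (generation m z n \<inter> open_arc x (x + r))"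
proof -
  define k where "k = \<lfloor>x / (2 * pi)\<rfloor>"
  have "of_int k \<le> x / (2 * pi)" "x / (2 * pi) \<le> of_int k + 1" unfolding k_def by linarith+
  then have k: "2 * pi * of_int k \<le> x" "x \<le> 2 * pi * of_int k + 2 * pi" by (simp_all add: field_simps)
  define y where "y = x - 2 * pi * of_int k"
  have "y \<in> {0..2 * pi}" using k by (simp add: y_def)
  then have "min_arc_count m z n r \<le> card (generation m z n \<inter> open_arc y (y + r))"
    unfolding min_arc_count_def by (intro Min_le min_arc_count_finite imageI)
  also have "open_arc y (y + r) = open_arc x (x + r)"
    using open_arc_shift[of y k "y + r"] by (simp add: y_def algebra_simps)
  finally show ?thesis .
qed

lemma min_arc_count_attained:
  obtains x where "min_arc_count m z n r = card (generation m z n \<inter> open_arc x (x + r))"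
proof -
  have "min_arc_count m z n r \<in> (\<lambda>x. card (generation m z n \<inter> open_arc x (x + r))) ` {0..2 * pi}"
    unfolding min_arc_count_def by (intro Min_in min_arc_count_finite) simp
  then show ?thesis using that by blast
qed

section \<open>Separated families: sums, cardinalities and sampling\<close>

text \<open>Capping the separation constant at 1 is harmless, since decreasing it preserves
  separation.\<close>

locale separated_points =
  fixes m :: "nat \<Rightarrow> nat" and z :: "nat \<Rightarrow> nat \<Rightarrow> complex" and \<epsilon> :: real
  assumes m: "\<And>n. n \<le> m n"
    and unit: "\<And>n j. j \<le> m n \<Longrightarrow> norm (z n j) = 1"
    and \<epsilon>: "0 < \<epsilon>" "\<epsilon> \<le> 1"
    and sep: "\<And>n j k. 1 \<le> n \<Longrightarrow> j \<le> m n \<Longrightarrow> k \<le> m n \<Longrightarrow> j \<noteq> k \<Longrightarrow> \<epsilon> / real n \<le> norm (z n j - z n k)"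
begin

lemma inj_points: assumes "1 \<le> n" shows "inj_on (z n) {0..m n}"
proof (rule inj_onI, rule ccontr)
  fix j k assume jk: "j \<in> {0..m n}" "k \<in> {0..m n}" "z n j = z n k" "j \<noteq> k"
  then have "\<epsilon> / real n \<le> 0" using sep[OF assms, of j k] by simp
  then show False using \<epsilon> assms by (simp add: divide_le_0_iff)
qed

definition \<beta> :: real where "\<beta> = 12 + 8 * pi\<^sup>2 / \<epsilon>\<^sup>2"

lemma \<beta>_pos: "\<beta> > 0" by (simp add: \<beta>_def add_pos_nonneg)

text \<open>This is the lower Marcinkiewicz-Zygmund estimate, a consequence of separation. Here (n +
  1) / (2 pi) is bounded by n.\<close>

lemma sum_le_integral:
  assumes n: "1 \<le> n" and deg: "degree q \<le> n" and p: "1 \<le> p"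
  shows "(\<Sum>j=0..m n. norm (poly q (z n j)) powr p) \<le>
    3 powr p * \<beta> * real n * integral {0..2 * pi} (\<lambda>t. norm (poly q (cis t)) powr p)"
proof -
  let ?I = "integral {0..2 * pi} (\<lambda>t. norm (poly q (cis t)) powr p)"
  have I: "?I \<ge> 0"
    using p by (intro integral_nonneg integrable_continuous_real continuous_intros continuous_on_powr') auto
  have "(\<Sum>j=0..m n. norm (poly q (z n j)) powr p) \<le> 3 powr p * (real (n + 1) / (2 * pi)) * \<beta> * ?I"
    unfolding \<beta>_def
  proof (intro sum_point_bound \<epsilon>(1) deg p)
    fix j k assume jk: "j \<in> {0..m n}" "k \<in> {0..m n}" "j \<noteq> k"
    have "\<epsilon> / real (n + 1) \<le> \<epsilon> / real n" using n \<epsilon> by (intro divide_left_mono) auto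
    also have "\<dots> \<le> norm (z n j - z n k)" using jk n by (intro sep) auto
    finally show "\<epsilon> / real (n + 1) \<le> norm (z n j - z n k)" .
  qed (auto intro: unit)
  also have "\<dots> \<le> 3 powr p * real n * \<beta> * ?I"
  proof -
    have "real (n + 1) / (2 * pi) \<le> real n"
    proof -
      have "real (n + 1) \<le> real n * 2" using n by simp
      also have "\<dots> \<le> real n * (2 * pi)" using pi_gt3 by (intro mult_left_mono) auto
      finally show ?thesis by (simp add: divide_le_eq mult.commute)
    qed
    then show ?thesis using \<beta>_pos I by (intro mult_right_mono mult_left_mono) auto
  qed
  finally show ?thesis by (simp only: mult_ac)
qed

text \<open>The constant polynomial 1 with exponent 1 in \<open>sum_le_integral\<close> counts the
  points. Thus \<open>m n\<close> and \<open>n\<close> are comparable and the normalizations 1 / n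
  and 1 / \<open>m n\<close> can be exchanged.\<close>

lemma card_points_le:
  assumes n: "1 \<le> n"
  shows "real (m n) \<le> 6 * pi * \<beta> * real n"
proof -
  have "real (m n) + 1 = (\<Sum>j=0..m n. norm (poly (1::complex poly) (z n j)) powr 1)" by simp
  also have "\<dots> \<le> 3 powr 1 * \<beta> * real n * integral {0..2 * pi} (\<lambda>t. norm (poly (1::complex poly) (cis t)) powr 1)"
    using n by (intro sum_le_integral) auto
  also have "\<dots> = 6 * pi * \<beta> * real n" by simp
  finally show ?thesis by simp
qed

text \<open>The first n + 1 nodes already determine \<open>q\<close> as its own Lagrange
  interpolant. The constant depends on \<open>n\<close>, so this serves for the finitely many
  generations to which the density does not speak.\<close>

lemma small_degree_sampling:
  assumes n: "1 \<le> n" and deg: "degree q \<le> n"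
    and \<delta>: "\<And>j. j \<le> m n \<Longrightarrow> norm (poly q (z n j)) \<le> \<delta>" and w: "norm w = 1"
  shows "norm (poly q w) \<le> real (n + 1) * (2 * real n / \<epsilon>) ^ (n + 1) * \<delta>"
proof -
  define X where "X = z n ` {0..n}"
  have inj: "inj_on (z n) {0..n}" by (rule inj_on_subset[OF inj_points[OF n]]) (use m[of n] in auto)
  have X: "finite X" "card X = n + 1" by (auto simp: X_def card_image[OF inj])
  have le: "j \<le> m n" if "j \<in> {0..n}" for j using that m[of n] by simp
  obtain P where P: "degree P \<le> card X - 1" "\<And>x. x \<in> X \<Longrightarrow> poly P x = poly q x"
    "\<And>s. norm s \<le> 1 \<Longrightarrow> norm (poly P s) \<le> real (card X) * (2 * 1 / (\<epsilon> / real n)) ^ card X * \<delta>"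
  proof (rule Lagrange_interpolation_bounded[of X 1 "\<epsilon> / real n" "poly q" \<delta>])
    show "norm x \<le> 1" if "x \<in> X" for x using that unit le by (auto simp: X_def)
    show "0 < \<epsilon> / real n" using \<epsilon> n by simp
    have "\<epsilon> / real n \<le> 1 / 1" using \<epsilon> n by (intro frac_le) auto
    then show "\<epsilon> / real n \<le> 2 * 1" by simp
    show "\<epsilon> / real n \<le> norm (x - y)" if xy: "x \<in> X" "y \<in> X" "x \<noteq> y" for x y
    proof -
      obtain i j where "i \<in> {0..n}" "j \<in> {0..n}" "x = z n i" "y = z n j" using xy by (auto simp: X_def)
      then show ?thesis using xy le n by (auto intro!: sep)
    qed
    show "norm (poly q x) \<le> \<delta>" if "x \<in> X" for x using that \<delta> le by (auto simp: X_def)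
  qed (use X in auto)
  have "q = P"
  proof (rule ccontr)
    assume "q \<noteq> P"
    then have nz: "q - P \<noteq> 0" by simp
    have "card X \<le> card {x. poly (q - P) x = 0}"
      using P(2) by (intro card_mono poly_roots_finite nz) auto
    also have "\<dots> \<le> degree (q - P)" using nz by (rule card_poly_roots_bound)
    also have "\<dots> \<le> n" using P(1) X(2) deg by (intro degree_diff_le) auto
    finally show False using X(2) by simp
  qed
  then show ?thesis using P(3)[of w] w by (simp add: X(2))
qed

text \<open>Maximum norm sampling for degree at most \<open>N\<close> with constant
  \<open>C\<close>. An arbitrary bound \<delta> replaces the supremum of the samples, so that any
  estimate at the nodes can be inserted directly.\<close>

definition samples :: "nat \<Rightarrow> nat \<Rightarrow> real \<Rightarrow> bool" where
  "samples n N C \<longleftrightarrow> (\<forall>q \<delta> w. degree q \<le> N \<longrightarrow> (\<forall>j\<le>m n. norm (poly q (z n j)) \<le> \<delta>) \<longrightarrow> norm w = 1 \<longrightarrow>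
     norm (poly q w) \<le> C * \<delta>)"

lemma samplesD:
  assumes "samples n N C" "degree q \<le> N" "\<And>j. j \<le> m n \<Longrightarrow> norm (poly q (z n j)) \<le> \<delta>" "norm w = 1"
  shows "norm (poly q w) \<le> C * \<delta>"
  using assms unfolding samples_def by blast

lemma uniform_sampling:
  assumes dense: "lower_density m z > ereal (1 / (2 * pi))"
  obtains C \<eta> :: real and M :: "nat \<Rightarrow> nat" where "C > 0" "\<eta> > 0"
    "\<forall>n\<ge>1. \<eta> * real n \<le> real (M n + 1)" "\<forall>n\<ge>1. samples n (n + 2 * M n) C"
proof -
  have "\<forall>\<^sub>F R in at_top. ereal (1 / (2 * pi)) <
      liminf (\<lambda>n. ereal (real (min_arc_count m z n (R / real n)) / R)) \<and> (R::real) \<ge> 1"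
    using less_LiminfD[OF dense[unfolded lower_density_def]] eventually_ge_at_top
    by (rule eventually_conj)
  from eventually_happens'[OF _ this] obtain R :: real where
    "ereal (1 / (2 * pi)) < liminf (\<lambda>n. ereal (real (min_arc_count m z n (R / real n)) / R))" and R: "R \<ge> 1"
    by auto
  from less_LiminfD[OF this(1)] obtain n1 where
    n1: "\<And>n. n \<ge> n1 \<Longrightarrow> 1 / (2 * pi) < real (min_arc_count m z n (R / real n)) / R"
    by (auto simp: eventually_sequentially)
  \<comment> \<open>The least integer strictly above R / (2 pi); an integer count exceeding R / (2
    pi) is therefore at least \<open>c\<close>.\<close>
  define c where "c = nat \<lfloor>R / (2 * pi)\<rfloor> + 1"
  have c: "real c > R / (2 * pi)" unfolding c_def by linarith
  have count: "c \<le> card (generation m z n \<inter> open_arc x (x + R / real n))" if "n \<ge> n1" for n x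
  proof -
    have "R / (2 * pi) < real (min_arc_count m z n (R / real n))"
      using n1[OF that] R by (simp add: field_simps)
    then have "\<lfloor>R / (2 * pi)\<rfloor> < int (min_arc_count m z n (R / real n))" by linarith
    then have "nat \<lfloor>R / (2 * pi)\<rfloor> < min_arc_count m z n (R / real n)" using R by (simp add: nat_less_iff)
    then have "c \<le> min_arc_count m z n (R / real n)" by (simp add: c_def)
    then show ?thesis using min_arc_count_le by (rule order.trans)
  qed
  obtain e :: real and K L :: nat where eKL: "e > 0" "K \<ge> 1" "L \<ge> 1"
    "2 * exp ((1 + e) / 2 * (real L * R) / (real K * sin (pi / (2 * real K)))) \<le> (real L ^ L / fact L) ^ (2 * c)"
    using Jensen_constants[of R c] R c by auto
  define N where "N = n1 + 1"
  define C1 where "C1 = 3 * (real (2 * L * c) * (2 * (real L * R) / \<epsilon>) ^ (2 * L * c))"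
  define C2 where "C2 = (\<lambda>n. real (n + 1) * (2 * real n / \<epsilon>) ^ (n + 1))"
  define C where "C = 1 + C1 + (\<Sum>n<N. C2 n)"
  \<comment> \<open>For n < N there is no spare degree and \<eta> n \<le> 1 suffices; for larger n
    the spare degree plus 1 is at least e n / 2. The shift in \<open>N = n1 + 1\<close> keeps 1 / N
    positive.\<close>
  define \<eta> where "\<eta> = min (e / 2) (1 / real N)"
  define M where "M = (\<lambda>n. if n < N then 0 else nat \<lfloor>e * real n / 2\<rfloor>)"
  have C1: "C1 \<ge> 0" using R \<epsilon> by (simp add: C1_def)
  have C2: "C2 n \<ge> 0" for n using \<epsilon> by (simp add: C2_def)
  have "0 \<le> (\<Sum>n<N. C2 n)" using C2 by (intro sum_nonneg)
  then have C: "C > 0" "C1 \<le> C" using C1 unfolding C_def by linarith+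
  have C2C: "C2 n \<le> C" if "n < N" for n
  proof -
    have "C2 n \<le> (\<Sum>n<N. C2 n)" using that C2 by (intro member_le_sum) auto
    then show ?thesis using C1 by (simp add: C_def)
  qed
  show ?thesis
  proof (rule that[OF C(1)]; (unfold samples_def)?; (intro allI impI)?)
    show "\<eta> > 0" using eKL by (simp add: \<eta>_def N_def)
    show "\<eta> * real n \<le> real (M n + 1)" if "1 \<le> n" for n
    proof (cases "n < N")
      case True
      have "\<eta> * real n \<le> 1 / real N * real N"
        using True by (intro mult_mono) (auto simp: \<eta>_def)
      then show ?thesis by (simp add: M_def N_def)
    next
      case False
      have "\<eta> * real n \<le> e / 2 * real n" by (intro mult_right_mono) (auto simp: \<eta>_def)
      also have "\<dots> \<le> real (nat \<lfloor>e * real n / 2\<rfloor> + 1)" using eKL(1) by (simp; linarith)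
      finally show ?thesis using False by (simp add: M_def)
    qed
  next
    fix n :: nat and q :: "complex poly" and \<delta> :: real and w :: complex
    assume n: "1 \<le> n" and deg: "degree q \<le> n + 2 * M n"
      and "\<forall>j\<le>m n. norm (poly q (z n j)) \<le> \<delta>" and w: "norm w = 1"
    then have \<delta>: "norm (poly q (z n j)) \<le> \<delta>" if "j \<le> m n" for j using that by blast
    have \<delta>0: "\<delta> \<ge> 0" using \<delta>[of 0] norm_ge_zero order_trans by blast
    show "norm (poly q w) \<le> C * \<delta>"
    proof (cases "n < N")
      case True
      then have "norm (poly q w) \<le> C2 n * \<delta>"
        unfolding C2_def using deg by (intro small_degree_sampling n \<delta> w) (auto simp: M_def)
      also have "\<dots> \<le> C * \<delta>" using C2C[OF True] \<delta>0 by (intro mult_right_mono)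
      finally show ?thesis .
    next
      case False
      have "norm (poly q w) \<le> C1 * \<delta>"
        unfolding C1_def
      proof (rule poly_sampling[where Z = "generation m z n" and c = c])
        show "c \<le> card (generation m z n \<inter> open_arc x (x + R / real n))" for x
          using False by (intro count) (auto simp: N_def)
        have "real (nat \<lfloor>e * real n / 2\<rfloor>) \<le> e * real n / 2"
        proof -
          have "0 \<le> e * real n / 2" using eKL(1) by simp
          then show ?thesis by linarith
        qed
        moreover have "real (degree q) \<le> real n + 2 * real (nat \<lfloor>e * real n / 2\<rfloor>)"
          using deg False by (simp add: M_def)
        ultimately show "real (degree q) \<le> (1 + e) * real n" by (simp add: algebra_simps)
        show "\<epsilon> / real n \<le> norm (u - v)" if uv: "u \<in> generation m z n" "v \<in> generation m z n" "u \<noteq> v" for u v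
        proof -
          obtain i j where "i \<le> m n" "j \<le> m n" "u = z n i" "v = z n j"
            using uv by (auto simp: generation_def)
          then show ?thesis using uv n by (auto intro!: sep)
        qed
      qed (use n \<epsilon> R eKL \<delta> \<delta>0 w in \<open>auto simp: generation_def\<close>)
      also have "\<dots> \<le> C * \<delta>" using C(2) \<delta>0 by (intro mult_right_mono)
      finally show ?thesis .
    qed
  qed
qed

lemma dense_imp_MZ_infinity:
  assumes "lower_density m z > ereal (1 / (2 * pi))"
  shows "MZ_family_infinity m z"
proof -
  obtain C \<eta> M where C: "C > 0" "\<eta> > 0" and M: "\<forall>n\<ge>1. \<eta> * real n \<le> real (M n + 1)"
    and samp: "\<forall>n\<ge>1. samples n (n + 2 * M n) C"
    by (rule uniform_sampling[OF assms])
  show ?thesis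
    unfolding MZ_family_infinity_def
  proof (intro exI[of _ C] conjI C(1) allI impI)
    fix n :: nat and q :: "complex poly" assume n: "1 \<le> n" and deg: "degree q \<le> n"
    show "(SUP w\<in>sphere 0 1. norm (poly q w)) \<le> C * (SUP j\<in>{0..m n}. norm (poly q (z n j)))"
    proof (rule cSUP_least)
      fix w :: complex assume "w \<in> sphere 0 1"
      then show "norm (poly q w) \<le> C * (SUP j\<in>{0..m n}. norm (poly q (z n j)))"
        by (intro samplesD[OF samp[rule_format, OF n]] cSUP_upper) (use deg in auto)
    qed simp
  qed
qed

text \<open>For the upper estimate, maximum norm sampling is applied to \<open>q\<close> times the
  squared kernel polynomial centred at \<open>cis t\<close>. The maximum over the nodes is bounded
  by a sum, and integration in \<open>t\<close> replaces each kernel by its integral.\<close>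

lemma dense_imp_MZ_finite:
  assumes "lower_density m z > ereal (1 / (2 * pi))" and p: "1 \<le> (p::real)"
  shows "MZ_family_finite p m z"
proof -
  obtain C \<eta> M where C: "C > 0" "\<eta> > 0" and M: "\<forall>n\<ge>1. \<eta> * real n \<le> real (M n + 1)"
    and samp: "\<forall>n\<ge>1. samples n (n + 2 * M n) C"
    by (rule uniform_sampling[OF assms(1)])
  define A1 where "A1 = 3 powr p * \<beta>"
  \<comment> \<open>Sampling constant, integral of a kernel up to the factor 1 / n, and the ratio of
    \<open>m n\<close> to \<open>n\<close>.\<close>
  define A2 where "A2 = C powr p * (2 * pi / \<eta>) * (6 * pi * \<beta>)"
  define A where "A = A1 + A2"
  have A1: "A1 > 0" using \<beta>_pos by (simp add: A1_def)
  have A2: "A2 > 0" using \<beta>_pos C by (simp add: A2_def)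
  show ?thesis
    unfolding MZ_family_finite_def
  proof (intro exI[of _ A] conjI allI impI)
    show "0 < A" using A1 A2 by (simp add: A_def)
    fix n :: nat and q :: "complex poly" assume n: "1 \<le> n" and deg: "degree q \<le> n"
    have mn: "real (m n) > 0" "real n \<le> real (m n)" using m[of n] n by auto
    let ?S = "\<Sum>j=0..m n. norm (poly q (z n j)) powr p"
    let ?x = "\<lambda>t. norm (poly q (cis t)) powr p"
    have intp: "?x integrable_on {0..2 * pi}"
      using p by (intro integrable_continuous_real continuous_intros continuous_on_powr') auto
    have I: "integral {0..2 * pi} ?x \<ge> 0" using intp by (intro integral_nonneg) auto
    have S: "?S \<ge> 0" by (intro sum_nonneg) auto
    have "?S \<le> A1 * real n * integral {0..2 * pi} ?x"
      unfolding A1_def by (rule sum_le_integral[OF n deg p])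
    also have "\<dots> \<le> A * real (m n) * integral {0..2 * pi} ?x"
      using I A1 A2 mn by (intro mult_mono) (auto simp: A_def)
    finally have "inverse (A * real (m n)) * ?S
        \<le> inverse (A * real (m n)) * (A * real (m n) * integral {0..2 * pi} ?x)"
      using A1 A2 by (intro mult_left_mono) (auto simp: A_def)
    moreover have "inverse (A * real (m n)) * (A * real (m n) * integral {0..2 * pi} ?x) = integral {0..2 * pi} ?x"
    proof -
      have "A * real (m n) \<noteq> 0" using A1 A2 mn by (simp add: A_def)
      then show ?thesis by (metis left_inverse mult.assoc mult_1_left)
    qed
    ultimately show "inverse A / real (m n) * ?S \<le> integral {0..2 * pi} ?x"
      by (simp only: inverse_mult_distrib divide_inverse)
    let ?F = "\<lambda>j t. norm (dmean (M n) (cis t * cnj (z n j))) ^ 2"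
    have intF: "(?F j has_integral 2 * pi / real (M n + 1)) {0..2 * pi}" if "j \<le> m n" for j
      using that by (intro has_integral_norm_dmean_square unit)
    \<comment> \<open>Sampling bounds the value at \<open>cis t\<close> by a single node
      \<open>i\<close>, where the maximum is attained. As the kernel is at most 1, its p-th power is
      at most itself, and the term for \<open>i\<close> is part of the sum.\<close>
    have pointwise: "?x t \<le> (\<Sum>j=0..m n. C powr p * norm (poly q (z n j)) powr p * ?F j t)" for t
    proof -
      obtain D where D: "degree D \<le> M n" "\<And>v. poly D v = dmean (M n) (v * cnj (cis t))"
        using dmean_poly by blast
      define P where "P = q * D * D"
      have degP: "degree P \<le> n + 2 * M n"
        using degree_mult_le[of "q * D" D] degree_mult_le[of q D] deg D(1) unfolding P_def by linarith
      have Pt: "poly P (cis t) = poly q (cis t)"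
        by (simp add: P_def D cis_cnj cis_mult)
      have Pj: "norm (poly P (z n j)) = norm (poly q (z n j)) * ?F j t" for j
        unfolding norm_dmean_swap[of _ "cis t"]
        by (simp add: P_def D norm_mult power2_eq_square)
      define \<delta> where "\<delta> = Max ((\<lambda>j. norm (poly P (z n j))) ` {0..m n})"
      have "\<delta> \<in> (\<lambda>j. norm (poly P (z n j))) ` {0..m n}"
        unfolding \<delta>_def by (intro Max_in) auto
      then obtain i where i: "i \<le> m n" "\<delta> = norm (poly P (z n i))" by auto
      have \<delta>: "norm (poly P (z n j)) \<le> \<delta>" if "j \<le> m n" for j
        unfolding \<delta>_def using that by (intro Max_ge) auto
      have "norm (poly P (cis t)) \<le> C * norm (poly P (z n i))"
        unfolding i(2)[symmetric] by (rule samplesD[OF samp[rule_format, OF n] degP \<delta>]) auto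
      then have le: "norm (poly q (cis t)) \<le> C * (norm (poly q (z n i)) * ?F i t)" by (simp only: Pt Pj)
      have F: "0 \<le> ?F i t" "?F i t \<le> 1"
        using norm_dmean_le_1[of "cis t * cnj (z n i)" "M n"] unit[OF i(1)]
        by (auto simp: norm_mult power_le_one)
      have "?x t \<le> (C * (norm (poly q (z n i)) * ?F i t)) powr p"
        using le p by (intro powr_mono2) auto
      also have "\<dots> = C powr p * norm (poly q (z n i)) powr p * ?F i t powr p"
        using C F by (simp add: powr_mult)
      also have "\<dots> \<le> C powr p * norm (poly q (z n i)) powr p * ?F i t"
        using powr_mono'[OF p F] F by (intro mult_left_mono) auto
      also have "\<dots> \<le> (\<Sum>j=0..m n. C powr p * norm (poly q (z n j)) powr p * ?F j t)"
        using i(1) by (intro member_le_sum[where f = "\<lambda>j. C powr p * norm (poly q (z n j)) powr p * ?F j t"]) auto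
      finally show ?thesis .
    qed
    have "integral {0..2 * pi} ?x \<le> (\<Sum>j=0..m n. C powr p * norm (poly q (z n j)) powr p * (2 * pi / real (M n + 1)))"
    proof (rule has_integral_le[OF integrable_integral[OF intp]])
      show "((\<lambda>t. \<Sum>j=0..m n. C powr p * norm (poly q (z n j)) powr p * ?F j t) has_integral
        (\<Sum>j=0..m n. C powr p * norm (poly q (z n j)) powr p * (2 * pi / real (M n + 1)))) {0..2 * pi}"
        by (intro has_integral_sum has_integral_mult_right intF) auto
    qed (rule pointwise)
    also have "\<dots> = C powr p * (2 * pi / real (M n + 1)) * ?S"
      by (simp add: sum_distrib_left sum_divide_distrib mult_ac)
    also have "\<dots> \<le> C powr p * (2 * pi / (\<eta> * real n)) * ?S"
      using M[rule_format, OF n] C n S by (intro mult_right_mono mult_left_mono divide_left_mono) auto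
    also have "\<dots> \<le> A2 / real (m n) * ?S"
    proof (intro mult_right_mono S)
      have "1 / real n \<le> 6 * pi * \<beta> / real (m n)"
        using card_points_le[OF n] n mn by (simp add: field_simps)
      then have "C powr p * (2 * pi / \<eta>) * (1 / real n) \<le> C powr p * (2 * pi / \<eta>) * (6 * pi * \<beta> / real (m n))"
        using C by (intro mult_left_mono) auto
      then show "C powr p * (2 * pi / (\<eta> * real n)) \<le> A2 / real (m n)" by (simp add: A2_def)
    qed
    also have "\<dots> \<le> A / real (m n) * ?S"
      using A1 S mn by (intro mult_right_mono divide_right_mono) (auto simp: A_def)
    finally show "integral {0..2 * pi} ?x \<le> A / real (m n) * ?S" .
  qed
qed

end

section \<open>Density of Marcinkiewicz-Zygmund families\<close>

text \<open>Gaussian elimination by induction on the equations: equation \<open>i0\<close> either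
  has only zero coefficients or eliminates an unknown \<open>k0\<close>.\<close>

lemma homogeneous_system_nontrivial_solution:
  fixes a :: "'k \<Rightarrow> 'i \<Rightarrow> 'f::field"
  assumes "finite I" "finite T" "card I < card T"
  obtains c where "\<exists>k\<in>T. c k \<noteq> 0" "\<And>i. i \<in> I \<Longrightarrow> (\<Sum>k\<in>T. c k * a k i) = 0"
proof -
  have "\<exists>c. (\<exists>k\<in>T. c k \<noteq> 0) \<and> (\<forall>i\<in>I. (\<Sum>k\<in>T. c k * a k i) = 0)"
    using assms
  proof (induction I arbitrary: T a rule: finite_induct)
    case empty
    then obtain k where "k \<in> T" by fastforce
    then show ?case by (intro exI[of _ "\<lambda>_. 1"]) auto
  next
    case (insert i0 I)
    show ?case
    proof (cases "\<forall>k\<in>T. a k i0 = 0")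
      case True
      have "card I < card T" using insert by simp
      from insert.IH[OF insert.prems(1) this, of a] obtain c where
        "\<exists>k\<in>T. c k \<noteq> 0" "\<forall>i\<in>I. (\<Sum>k\<in>T. c k * a k i) = 0" by blast
      then show ?thesis using True by (intro exI[of _ c]) auto
    next
      case False
      then obtain k0 where k0: "k0 \<in> T" "a k0 i0 \<noteq> 0" by auto
      define T' where "T' = T - {k0}"
      have T': "finite T'" "T = insert k0 T'" "k0 \<notin> T'" using k0 insert.prems by (auto simp: T'_def)
      define a' where "a' = (\<lambda>k i. a k i - a k i0 / a k0 i0 * a k0 i)"
      have "card I < card T'" using insert T' by simp
      from insert.IH[OF T'(1) this, of a'] obtain c where
        c: "\<exists>k\<in>T'. c k \<noteq> 0" "\<And>i. i \<in> I \<Longrightarrow> (\<Sum>k\<in>T'. c k * a' k i) = 0" by blast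
      \<comment> \<open>The value of the eliminated unknown forced by equation \<open>i0\<close>;
        with it the original sums equal those of the reduced system \<open>a'\<close>.\<close>
      define c0 where "c0 = - (\<Sum>k\<in>T'. c k * (a k i0 / a k0 i0))"
      have sum: "(\<Sum>k\<in>T. (c(k0 := c0)) k * a k i) = (\<Sum>k\<in>T'. c k * a' k i)" for i
      proof -
        have "(\<Sum>k\<in>T. (c(k0 := c0)) k * a k i) = c0 * a k0 i + (\<Sum>k\<in>T'. (c(k0 := c0)) k * a k i)"
          unfolding T'(2) using T' by simp
        also have "(\<Sum>k\<in>T'. (c(k0 := c0)) k * a k i) = (\<Sum>k\<in>T'. c k * a k i)"
          using T'(3) by (intro sum.cong) auto
        also have "c0 * a k0 i + \<dots> = (\<Sum>k\<in>T'. c k * a' k i)"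
          by (simp add: c0_def a'_def sum_distrib_right right_diff_distrib sum_subtractf mult.assoc)
        finally show ?thesis .
      qed
      have "(\<Sum>k\<in>T'. c k * a' k i0) = 0" using k0 by (simp add: a'_def)
      then have "\<forall>i\<in>insert i0 I. (\<Sum>k\<in>T. (c(k0 := c0)) k * a k i) = 0"
        unfolding sum using c(2) by auto
      moreover have "\<exists>k\<in>T. (c(k0 := c0)) k \<noteq> 0" using c(1) T' by auto
      ultimately show ?thesis by blast
    qed
  qed
  then show ?thesis using that by blast
qed

context separated_points
begin

lemma MZ_infinity_imp_samples:
  assumes "MZ_family_infinity m z"
  obtains C where "C > 0" "\<forall>n\<ge>1. samples n n C"
proof -
  obtain C where C: "C > 0" and MZ: "\<And>n q. 1 \<le> n \<Longrightarrow> degree q \<le> n \<Longrightarrow>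
      (SUP w\<in>sphere 0 1. norm (poly q w)) \<le> C * (SUP j\<in>{0..m n}. norm (poly q (z n j)))"
    using assms unfolding MZ_family_infinity_def by blast
  have "samples n n C" if n: "1 \<le> n" for n
    unfolding samples_def
  proof (intro allI impI)
    fix q :: "complex poly" and \<delta> :: real and w :: complex
    assume deg: "degree q \<le> n" and \<delta>: "\<forall>j\<le>m n. norm (poly q (z n j)) \<le> \<delta>" and w: "norm w = 1"
    have "bdd_above ((\<lambda>w. norm (poly q w)) ` sphere 0 1)"
      by (intro compact_imp_bounded[THEN bounded_imp_bdd_above] compact_continuous_image)
         (auto intro!: continuous_intros)
    then have "norm (poly q w) \<le> (SUP w\<in>sphere 0 1. norm (poly q w))"
      using w by (intro cSUP_upper) auto
    also have "\<dots> \<le> C * (SUP j\<in>{0..m n}. norm (poly q (z n j)))" by (rule MZ[OF n deg])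
    also have "\<dots> \<le> C * \<delta>"
      using C \<delta> by (intro mult_left_mono cSUP_least) auto
    finally show "norm (poly q w) \<le> C * \<delta>" .
  qed
  then show ?thesis using that[OF C] by blast
qed

text \<open>The p-th power inequality is applied to \<open>P = q * D * D\<close>, which agrees with
  \<open>q\<close> at \<open>w\<close>. At the nodes the kernel factors have bounded sum, so small
  samples of \<open>q\<close> give a bounded multiple of \<delta>^p. Multiplying by D twice is what
  reduces the admissible degree to n - 2 M.\<close>

lemma MZ_finite_imp_samples:
  assumes "MZ_family_finite p m z" and p: "1 \<le> p" and e: "e > 0"
  obtains C where "C > 0" "\<forall>n\<ge>1. \<forall>M. e * real n \<le> real (M + 1) \<longrightarrow> 2 * M \<le> n \<longrightarrow> samples n (n - 2 * M) C"
proof -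
  obtain C0 where C0: "C0 > 0" and MZ: "\<And>n q. 1 \<le> n \<Longrightarrow> degree q \<le> n \<Longrightarrow>
     integral {0..2 * pi} (\<lambda>\<theta>. norm (poly q (cis \<theta>)) powr p)
          \<le> C0 / real (m n) * (\<Sum>j=0..m n. norm (poly q (z n j)) powr p)"
    using assms(1) unfolding MZ_family_finite_def by blast
  define B where "B = 12 + 8 * pi\<^sup>2 / (\<epsilon> * e)\<^sup>2"
  have B: "B > 0" by (simp add: B_def add_pos_nonneg)
  define G where "G = 3 powr p * (C0 * B)"
  have G: "G > 0" using B C0 by (simp add: G_def)
  define C where "C = G powr (1 / p)"
  have C: "C > 0" using G by (simp add: C_def)
  have Cp: "C powr p = G" using G p by (simp add: C_def powr_powr)
  have "samples n (n - 2 * M) C" if n: "1 \<le> n" and M: "e * real n \<le> real (M + 1)" "2 * M \<le> n" for n M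
    unfolding samples_def
  proof (intro allI impI)
    fix q :: "complex poly" and \<delta> :: real and w :: complex
    assume deg: "degree q \<le> n - 2 * M" and \<delta>: "\<forall>j\<le>m n. norm (poly q (z n j)) \<le> \<delta>" and w: "norm w = 1"
    have \<delta>0: "\<delta> \<ge> 0" using \<delta> norm_ge_zero order_trans by blast
    have mn: "real (m n) > 0" "real n \<le> real (m n)" using m[of n] n by auto
    let ?F = "\<lambda>j. norm (dmean M (z n j * cnj w)) ^ 2"
    obtain D where D: "degree D \<le> M" "\<And>v. poly D v = dmean M (v * cnj w)"
      using dmean_poly by blast
    define P where "P = q * D * D"
    have degP: "degree P \<le> n"
      using degree_mult_le[of "q * D" D] degree_mult_le[of q D] deg D(1) M(2) unfolding P_def by linarith
    have "w * cnj w = 1" using w by (simp add: complex_norm_square[symmetric])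
    then have Pw: "poly P w = poly q w" by (simp add: P_def D)
    let ?x = "\<lambda>t. norm (poly P (cis t)) powr p"
    let ?K = "\<lambda>t. norm (dmean n (cis t * cnj w)) ^ 2"
    have int: "?x integrable_on {0..2 * pi}" "(\<lambda>t. ?x t * ?K t) integrable_on {0..2 * pi}"
      using p by (intro integrable_continuous_real continuous_intros continuous_on_powr'; auto)+
    have I: "0 \<le> integral {0..2 * pi} ?x" using int(1) by (intro integral_nonneg) auto
    have "norm (poly q w) powr p \<le> 3 powr p * (real (n + 1) / (2 * pi)) * integral {0..2 * pi} (\<lambda>t. ?x t * ?K t)"
      using point_bound[OF w degP p] by (simp only: Pw)
    also have "\<dots> \<le> 3 powr p * (real (n + 1) / (2 * pi)) * integral {0..2 * pi} ?x"
    \<comment> \<open>The kernel from \<open>point_bound\<close> is simply bounded by 1, since the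
      localization is already contained in \<open>P\<close>.\<close>
    proof (intro mult_left_mono integral_le int)
      fix t
      have "norm (dmean n (cis t * cnj w)) \<le> 1" using w by (intro norm_dmean_le_1) (simp add: norm_mult)
      then have "?K t \<le> 1" by (simp add: power_le_one)
      from mult_left_mono[OF this, of "?x t"] show "?x t * ?K t \<le> ?x t" by simp
    qed auto
    also have "\<dots> \<le> 3 powr p * real n * integral {0..2 * pi} ?x"
    proof -
      have "real (n + 1) \<le> real n * 2" using n by simp
      also have "\<dots> \<le> real n * (2 * pi)" using pi_gt3 by (intro mult_left_mono) auto
      finally have "real (n + 1) / (2 * pi) \<le> real n" by (simp add: divide_le_eq mult.commute)
      then show ?thesis using I by (intro mult_right_mono mult_left_mono) auto
    qed
    also have "\<dots> \<le> 3 powr p * real n * (C0 / real (m n) * (\<Sum>j=0..m n. norm (poly P (z n j)) powr p))"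
      by (intro mult_left_mono MZ n degP) auto
    also have "\<dots> \<le> 3 powr p * real n * (C0 / real (m n) * (\<Sum>j=0..m n. \<delta> powr p * ?F j))"
    proof (intro mult_left_mono sum_mono)
      fix j assume j: "j \<in> {0..m n}"
      have F: "0 \<le> ?F j" "?F j \<le> 1"
        using norm_dmean_le_1[of "z n j * cnj w" M] unit[of j n] j w
        by (auto simp: norm_mult power_le_one)
      have "norm (poly P (z n j)) = norm (poly q (z n j)) * ?F j"
        by (simp add: P_def D norm_mult power2_eq_square)
      also have "\<dots> \<le> \<delta> * ?F j" using \<delta> j by (intro mult_right_mono) auto
      finally have "norm (poly P (z n j)) powr p \<le> (\<delta> * ?F j) powr p" using p by (intro powr_mono2) auto
      also have "\<dots> = \<delta> powr p * ?F j powr p" using \<delta>0 F by (simp add: powr_mult)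
      also have "\<dots> \<le> \<delta> powr p * ?F j"
        using powr_mono'[OF p F] F by (intro mult_left_mono) auto
      finally show "norm (poly P (z n j)) powr p \<le> \<delta> powr p * ?F j" .
    qed (use C0 in auto)
    also have "(\<Sum>j=0..m n. \<delta> powr p * ?F j) = \<delta> powr p * (\<Sum>j=0..m n. ?F j)"
      by (simp only: sum_distrib_left)
    also have "3 powr p * real n * (C0 / real (m n) * (\<delta> powr p * (\<Sum>j=0..m n. ?F j)))
        \<le> 3 powr p * real n * (C0 / real (m n) * (\<delta> powr p * B))"
    proof (intro mult_left_mono)
      show "(\<Sum>j=0..m n. ?F j) \<le> B"
        unfolding B_def
      proof (rule sum_kernel_separated_le)
        fix j k assume jk: "j \<in> {0..m n}" "k \<in> {0..m n}" "j \<noteq> k"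
        \<comment> \<open>M + 1 \<ge> e n makes the nodes separated at the scale 1 / (M + 1) of the
          kernel.\<close>
        have "\<epsilon> * e / real (M + 1) \<le> \<epsilon> * e / (e * real n)"
          using M(1) \<epsilon> e n by (intro divide_left_mono) auto
        also have "\<dots> = \<epsilon> / real n" using e by simp
        also have "\<dots> \<le> norm (z n j - z n k)" using jk n by (intro sep) auto
        finally show "\<epsilon> * e / real (M + 1) \<le> norm (z n j - z n k)" .
      qed (use \<epsilon> e w unit in auto)
    qed (use C0 in auto)
    also have "\<dots> = G * \<delta> powr p * (real n / real (m n))" by (simp add: G_def)
    also have "\<dots> \<le> G * \<delta> powr p * 1"
      using mn G by (intro mult_left_mono) auto
    also have "\<dots> = (C * \<delta>) powr p" using C \<delta>0 by (simp add: powr_mult Cp)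
    finally have le: "norm (poly q w) powr p \<le> (C * \<delta>) powr p" .
    show "norm (poly q w) \<le> C * \<delta>"
    proof (rule ccontr)
      assume "\<not> norm (poly q w) \<le> C * \<delta>"
      then have "(C * \<delta>) powr p < norm (poly q w) powr p"
        using p C \<delta>0 by (intro powr_less_mono2) auto
      then show False using le by simp
    qed
  qed
  then show ?thesis using that[OF C] by blast
qed

lemma MZ_imp_samples:
  assumes "MZ_family p m z" and p: "1 \<le> p" and e: "e > 0"
  obtains C where "C > 0" "\<forall>n\<ge>1. \<forall>M. e * real n \<le> real (M + 1) \<longrightarrow> 2 * M \<le> n \<longrightarrow> samples n (n - 2 * M) C"
proof (cases "p = \<infinity>")
  case True
  then obtain C where C: "C > 0" "\<forall>n\<ge>1. samples n n C"
    using assms(1) MZ_infinity_imp_samples by (auto simp: MZ_family_def)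
  have "samples n (n - 2 * M) C" if "1 \<le> n" for n M
    using C(2) that unfolding samples_def by (meson diff_le_self order_trans)
  then show ?thesis using that C(1) by blast
next
  case False
  then obtain r where r: "p = ereal r" "1 \<le> r" using p by (cases p) auto
  then have "MZ_family_finite r m z" using assms(1) by (simp add: MZ_family_def)
  from MZ_finite_imp_samples[OF this r(2) e] show ?thesis using that by blast
qed

end

section \<open>Counting nodes in arcs\<close>

text \<open>A centre at angular distance at least \<open>h\<close> inside both ends of the arc has
  distance at least \<open>h\<close>, in either direction, from every point off the arc; the chord
  bound and \<open>dmean_decay\<close> finish.\<close>

lemma kernel_off_arc:
  assumes z: "norm z = 1" "z \<notin> open_arc x (x + b)" and \<phi>: "x + h \<le> \<phi>" "\<phi> \<le> x + b - h" and h: "h > 0"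
  shows "norm (dmean M (z * cnj (cis \<phi>))) \<le> pi / (real (M + 1) * h)"
proof -
  \<comment> \<open>Ceiling minus 1 instead of a floor puts the angle \<psi> into the interval open
    at \<open>x\<close> and closed at x + 2 pi. So the end point \<open>x\<close>, which is off the
    open arc, is represented by x + 2 pi and still lies beyond x + b.\<close>
  define k where "k = \<lceil>(Arg z - x) / (2 * pi)\<rceil> - 1"
  define \<psi> where "\<psi> = Arg z - 2 * pi * of_int k"
  have "of_int k < (Arg z - x) / (2 * pi)" "(Arg z - x) / (2 * pi) \<le> of_int k + 1"
    unfolding k_def by linarith+
  then have \<psi>: "x < \<psi>" "\<psi> \<le> x + 2 * pi" unfolding \<psi>_def by (simp_all add: field_simps)
  have zc: "z = cis \<psi>"
  proof -
    have "z = cis (Arg z)" using rcis_cmod_Arg[of z] z by (simp add: rcis_def)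
    then show ?thesis by (simp add: \<psi>_def cis_divide[symmetric] cis_multiple_2pi)
  qed
  then have "x + b \<le> \<psi>" using z(2) \<psi> by (force simp: open_arc_def)
  then have \<tau>: "h \<le> \<psi> - \<phi>" "\<psi> - \<phi> \<le> 2 * pi - h" using \<phi> \<psi> by auto
  have u: "z * cnj (cis \<phi>) = cis (\<psi> - \<phi>)" by (simp add: zc cis_cnj cis_mult)
  have "2 / pi * h \<le> norm (cis (\<psi> - \<phi>) - 1)"
  proof (cases "\<psi> - \<phi> \<le> pi")
    case True
    have "2 / pi * h \<le> 2 / pi * \<bar>\<psi> - \<phi>\<bar>" using \<tau> by (intro mult_left_mono) auto
    also have "\<dots> \<le> norm (cis (\<psi> - \<phi>) - 1)" using True \<tau> h by (intro chord_ge) auto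
    finally show ?thesis .
  next
    case False
    have "2 / pi * h \<le> 2 / pi * \<bar>\<psi> - \<phi> - 2 * pi\<bar>" using \<tau> by (intro mult_left_mono) auto
    also have "\<dots> \<le> norm (cis (\<psi> - \<phi> - 2 * pi) - 1)" using False \<tau> h by (intro chord_ge) auto
    also have "cis (\<psi> - \<phi> - 2 * pi) = cis (\<psi> - \<phi>)" by (simp add: cis_divide[symmetric])
    finally show ?thesis .
  qed
  then have "norm (dmean M (z * cnj (cis \<phi>))) * real (M + 1) * (2 / pi * h)
      \<le> norm (dmean M (z * cnj (cis \<phi>))) * real (M + 1) * norm (z * cnj (cis \<phi>) - 1)"
    unfolding u by (intro mult_left_mono) auto
  also have "\<dots> \<le> 2" using z by (intro dmean_decay) (simp add: norm_mult)
  finally have "norm (dmean M (z * cnj (cis \<phi>))) * real (M + 1) * (2 / pi * h) * (pi / 2) \<le> 2 * (pi / 2)"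
    by (intro mult_right_mono) auto
  then have "norm (dmean M (z * cnj (cis \<phi>))) * (real (M + 1) * h) \<le> pi" by (simp add: mult.assoc)
  then show ?thesis using h by (simp add: pos_le_divide_eq)
qed

context separated_points
begin

text \<open>
  The extremal polynomial is \<open>\<Sum>k. c k * dmean L (v / \<xi> k) * dmean M (v / \<xi> k) ^ 4\<close>. The first kernel makes its value at
  \<open>\<xi> l\<close> equal to \<open>c l\<close>, the \<open>\<xi> k\<close> being rotated roots of unity of order \<open>L + 1\<close>. Of the two factors \<open>F\<^sub>M\<close> in the fourth
  power, one is summed over \<open>k\<close> and the other gives the decay \<open>\<rho>\<^bsup>-2\<^esup>\<close> off the arc, because all \<open>\<xi> k\<close>
  keep distance \<open>\<rho> / n\<close> from its ends.
\<close>

lemma arc_count_ge: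
  assumes e: "0 < e" "e \<le> 1 / 12" and C: "C > 0"
    and samp: "\<forall>n\<ge>1. \<forall>M. e * real n \<le> real (M + 1) \<longrightarrow> 2 * M \<le> n \<longrightarrow> samples n (n - 2 * M) C"
  obtains \<rho> where "\<rho> > 0"
    "\<And>n R x. 1 \<le> n \<Longrightarrow> 2 * \<rho> \<le> R \<Longrightarrow> R \<le> pi * real n \<Longrightarrow>
       (R - 2 * \<rho>) * ((1 - 6 * e) / (2 * pi)) \<le> real (card (generation m z n \<inter> open_arc x (x + R / real n)))"
proof -
  define B where "B = 12 + 8 * pi\<^sup>2 / (2 * e)\<^sup>2"
  have B: "B > 0" by (simp add: B_def add_pos_nonneg)
  \<comment> \<open>Chosen to make the sampling inequality lose exactly a factor 1/2, as recorded
    next.\<close>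
  define \<rho> where "\<rho> = (pi / e) * sqrt (2 * C * B)"
  have \<rho>: "\<rho> > 0" using B C e by (simp add: \<rho>_def)
  have \<rho>B: "C * ((pi / (e * \<rho>))\<^sup>2 * B) = 1 / 2"
  proof -
    have "(e * \<rho>)\<^sup>2 = pi\<^sup>2 * (2 * C * B)"
      using e B C by (simp add: \<rho>_def power_mult_distrib)
    then show ?thesis using B C by (simp add: power_divide)
  qed
  have "(R - 2 * \<rho>) * ((1 - 6 * e) / (2 * pi)) \<le> real (card (generation m z n \<inter> open_arc x (x + R / real n)))"
    if n: "1 \<le> n" and R: "2 * \<rho> \<le> R" "R \<le> pi * real n" for n R x
  proof (rule ccontr)
    let ?Z = "generation m z n \<inter> open_arc x (x + R / real n)"
    assume "\<not> ?thesis"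
    then have small: "real (card ?Z) < (R - 2 * \<rho>) * ((1 - 6 * e) / (2 * pi))" by simp
    define M where "M = nat \<lfloor>e * real n\<rfloor>"
    have M: "real M \<le> e * real n" "e * real n \<le> real (M + 1)"
      using e unfolding M_def by (simp_all, linarith+)
    have "real (12 * M) \<le> real n"
    proof -
      have "e * real n \<le> 1 / 12 * real n" using e by (intro mult_right_mono) auto
      then show ?thesis using M(1) by simp
    qed
    then have M12: "12 * M \<le> n" by linarith
    \<comment> \<open>With four kernels of degree M the total degree is L + 4 M = n - 2 M, the
      degree for which sampling is known; still L + 1 \<ge> (1 - 6 e) n.\<close>
    define L where "L = n - 6 * M"
    have L: "(1 - 6 * e) * real n \<le> real (L + 1)" "real L \<le> real n"
      using M(1) M12 by (simp_all add: L_def of_nat_diff algebra_simps)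
    \<comment> \<open>The number of points with spacing 2 pi / (L + 1) that fit into the arc
      shortened by \<rho> / n at each end. The added 1 counts the starting point and makes
      \<open>T\<close> exceed the assumed number of nodes.\<close>
    define T where "T = nat \<lfloor>(R - 2 * \<rho>) * real (L + 1) / (2 * pi * real n)\<rfloor> + 1"
    have q0: "0 \<le> (R - 2 * \<rho>) * real (L + 1) / (2 * pi * real n)" using R by simp
    have T: "(R - 2 * \<rho>) * real (L + 1) / (2 * pi * real n) < real T"
      "real T - 1 \<le> (R - 2 * \<rho>) * real (L + 1) / (2 * pi * real n)"
      unfolding T_def using q0 by linarith+
    have "(R - 2 * \<rho>) * ((1 - 6 * e) / (2 * pi)) = (R - 2 * \<rho>) * ((1 - 6 * e) * real n) / (2 * pi * real n)"
      using n by simp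
    also have "\<dots> \<le> (R - 2 * \<rho>) * real (L + 1) / (2 * pi * real n)"
      using L(1) R by (intro divide_right_mono mult_left_mono) auto
    finally have card_lt: "card ?Z < card {..<T}" using small T(1) by simp
    define \<phi> where "\<phi> = (\<lambda>k::nat. x + \<rho> / real n + 2 * pi * real k / real (L + 1))"
    have step: "2 * pi * real k / real (L + 1) \<le> (R - 2 * \<rho>) / real n" if "k < T" for k
    proof -
      have "real k \<le> (R - 2 * \<rho>) * real (L + 1) / (2 * pi * real n)" using that T(2) by linarith
      then have "2 * pi * real k \<le> 2 * pi * ((R - 2 * \<rho>) * real (L + 1) / (2 * pi * real n))"
        by (intro mult_left_mono) auto
      also have "\<dots> = (R - 2 * \<rho>) / real n * real (L + 1)" by simp
      finally show ?thesis by (simp only: pos_divide_le_eq of_nat_0_less_iff)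
    qed
    have \<phi>: "x + \<rho> / real n \<le> \<phi> k" "\<phi> k \<le> x + R / real n - \<rho> / real n" if "k < T" for k
      using step[OF that] by (simp_all add: \<phi>_def diff_divide_distrib)
    \<comment> \<open>R \<le> pi n keeps all angular differences within [-pi, pi], where the chord
      bound holds.\<close>
    have step_pi: "\<bar>2 * pi * real k / real (L + 1) - 2 * pi * real l / real (L + 1)\<bar> \<le> pi" if "k < T" "l < T" for k l
    proof -
      have "(R - 2 * \<rho>) / real n \<le> pi" using R \<rho> n by (simp add: field_simps)
      then have "2 * pi * real k / real (L + 1) \<le> pi" "2 * pi * real l / real (L + 1) \<le> pi"
        using step that by (blast intro: order.trans)+
      moreover have "0 \<le> 2 * pi * real k / real (L + 1)" "0 \<le> 2 * pi * real l / real (L + 1)" by simp_all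
      ultimately show ?thesis by linarith
    qed
    define \<xi> where "\<xi> = (\<lambda>k. cis (\<phi> k))"
    have \<xi>\<xi>: "\<xi> k * cnj (\<xi> l) = cis (2 * pi * real k / real (L + 1) - 2 * pi * real l / real (L + 1))" for k l
      by (simp add: \<xi>_def \<phi>_def cis_cnj cis_mult)
    have \<xi>_dist: "4 / real (L + 1) \<le> norm (\<xi> k - \<xi> l)" if "k < T" "l < T" "k \<noteq> l" for k l
    proof -
      have "1 \<le> \<bar>real k - real l\<bar>" using that by linarith
      then have "4 / real (L + 1) * 1 \<le> 4 / real (L + 1) * \<bar>real k - real l\<bar>" by (intro mult_left_mono) auto
      also have "\<dots> = 2 / pi * \<bar>2 * pi * real k / real (L + 1) - 2 * pi * real l / real (L + 1)\<bar>"
        by (simp add: diff_divide_distrib[symmetric] right_diff_distrib[symmetric] abs_mult abs_divide del: of_nat_Suc of_nat_add)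
      also have "\<dots> \<le> norm (\<xi> k * cnj (\<xi> l) - 1)"
        unfolding \<xi>\<xi> by (intro chord_ge step_pi that)
      also have "\<dots> = norm (\<xi> k - \<xi> l)" by (intro norm_diff_unit) (simp add: \<xi>_def)
      finally show ?thesis by simp
    qed
    have \<xi>_orth: "dmean L (\<xi> k * cnj (\<xi> l)) = (if k = l then 1 else 0)" if "k < T" "l < T" for k l
    proof (cases "k = l")
      case True then show ?thesis by (simp add: \<xi>\<xi>)
    next
      case False
      have "0 < norm (\<xi> k - \<xi> l)" using \<xi>_dist[OF that False] by (rule less_le_trans[rotated]) simp
      moreover have "norm (\<xi> k * cnj (\<xi> l) - 1) = norm (\<xi> k - \<xi> l)"
        by (intro norm_diff_unit) (simp add: \<xi>_def)
      ultimately have "\<xi> k * cnj (\<xi> l) \<noteq> 1" by auto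
      moreover have "(\<xi> k * cnj (\<xi> l)) ^ (L + 1) = 1"
      proof -
        have "(\<xi> k * cnj (\<xi> l)) ^ (L + 1) = cis (real (L + 1) * (2 * pi * real k / real (L + 1) - 2 * pi * real l / real (L + 1)))"
          unfolding \<xi>\<xi> by (rule Complex.DeMoivre)
        also have "real (L + 1) * (2 * pi * real k / real (L + 1) - 2 * pi * real l / real (L + 1)) = 2 * pi * of_int (int k - int l)"
          by (simp add: right_diff_distrib del: of_nat_Suc of_nat_add)
        also have "cis \<dots> = 1" by (rule cis_multiple_2pi) (rule Ints_of_int)
        finally show ?thesis .
      qed
      ultimately show ?thesis using False dmean_root_of_unity by auto
    qed
    define a where "a = (\<lambda>k v. dmean L (v * cnj (\<xi> k)) * dmean M (v * cnj (\<xi> k)) ^ 4)"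
    \<comment> \<open>There are fewer nodes in the arc than kernels, so some nontrivial combination
      vanishes at all of them.\<close>
    obtain c where c: "\<exists>k\<in>{..<T}. c k \<noteq> 0" "\<And>v. v \<in> ?Z \<Longrightarrow> (\<Sum>k<T. c k * a k v) = 0"
      using homogeneous_system_nontrivial_solution[of ?Z "{..<T}" a] card_lt
      by (auto simp: generation_def)
    have "\<exists>DL. \<forall>k. degree (DL k) \<le> N \<and> (\<forall>v. poly (DL k) v = dmean N (v * cnj (\<xi> k)))" for N
      by (intro choice allI) (metis dmean_poly)
    then obtain DL DM where DL: "\<And>k. degree (DL k) \<le> L" "\<And>k v. poly (DL k) v = dmean L (v * cnj (\<xi> k))"
      and DM: "\<And>k. degree (DM k) \<le> M" "\<And>k v. poly (DM k) v = dmean M (v * cnj (\<xi> k))"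
      by metis
    define f where "f = (\<Sum>k<T. smult (c k) (DL k * DM k ^ 4))"
    have poly_f: "poly f v = (\<Sum>k<T. c k * a k v)" for v
      by (simp add: f_def poly_sum poly_power DL DM a_def)
    have deg_f: "degree f \<le> n - 2 * M"
      unfolding f_def
    proof (intro degree_sum_le finite_lessThan order.trans[OF degree_smult_le])
      fix k
      have "degree (DL k * DM k ^ 4) \<le> degree (DL k) + degree (DM k) * 4"
        by (intro order.trans[OF degree_mult_le] add_left_mono degree_power_le)
      also have "\<dots> \<le> L + M * 4" using DL(1) DM(1) by (intro add_mono mult_right_mono) auto
      also have "\<dots> = n - 2 * M" using M12 by (simp add: L_def)
      finally show "degree (DL k * DM k ^ 4) \<le> n - 2 * M" .
    qed
    have f_\<xi>: "poly f (\<xi> l) = c l" if l: "l < T" for l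
    proof -
      have "a k (\<xi> l) = (if k = l then 1 else 0)" if "k < T" for k
        using \<xi>_orth[OF l that] by (auto simp: a_def \<xi>\<xi>)
      then have "poly f (\<xi> l) = (\<Sum>k<T. if k = l then c l else 0)"
        unfolding poly_f by (intro sum.cong) auto
      then show ?thesis using l by simp
    qed
    define cmax where "cmax = Max ((\<lambda>k. norm (c k)) ` {..<T})"
    have T0: "{..<T} \<noteq> {}" by (auto simp: T_def)
    have cmax: "norm (c k) \<le> cmax" if "k < T" for k
      unfolding cmax_def using that by (intro Max_ge) auto
    have cmax_pos: "cmax > 0"
    proof -
      obtain k where "k < T" "c k \<noteq> 0" using c(1) by auto
      then show ?thesis using cmax[of k] by (metis norm_le_zero_iff not_le order_trans)
    qed
    obtain l where l: "l < T" "norm (c l) = cmax"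
    proof -
      have "cmax \<in> (\<lambda>k. norm (c k)) ` {..<T}" unfolding cmax_def using T0 by (intro Max_in) auto
      then show ?thesis using that by auto
    qed
    \<comment> \<open>The left side is the largest coefficient \<open>cmax\<close>, whereas sampling
      bounds it by \<open>cmax / 2\<close>: the contradiction.\<close>
    have "norm (poly f (\<xi> l)) \<le> C * (cmax * ((pi / (e * \<rho>))\<^sup>2 * B))"
    proof (rule samplesD[OF _ deg_f])
      show "samples n (n - 2 * M) C" using samp n M(2) M12 by auto
      show "norm (\<xi> l) = 1" by (simp add: \<xi>_def)
      fix j assume j: "j \<le> m n"
      let ?v = "z n j"
      have v: "norm ?v = 1" by (rule unit[OF j])
      show "norm (poly f ?v) \<le> cmax * ((pi / (e * \<rho>))\<^sup>2 * B)"
      proof (cases "?v \<in> open_arc x (x + R / real n)")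
        case True
        then have "poly f ?v = 0" unfolding poly_f using j by (intro c(2)) (auto simp: generation_def)
        then show ?thesis using cmax_pos B by simp
      next
        case False
        let ?d = "\<lambda>k. norm (dmean M (?v * cnj (\<xi> k)))"
        have vk: "norm (?v * cnj (\<xi> k)) = 1" for k using v by (simp add: norm_mult \<xi>_def)
        have term_le: "norm (c k * a k ?v) \<le> cmax * ((pi / (e * \<rho>))\<^sup>2 * ?d k ^ 2)" if k: "k < T" for k
        proof -
          have "?d k \<le> pi / (real (M + 1) * (\<rho> / real n))"
            unfolding \<xi>_def using \<phi>[OF k] \<rho> n False v by (intro kernel_off_arc) auto
          also have "\<dots> \<le> pi / (e * real n * (\<rho> / real n))"
            using M(2) \<rho> n e by (intro divide_left_mono mult_right_mono) auto
          also have "\<dots> = pi / (e * \<rho>)" using n by simp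
          finally have d: "?d k ^ 2 \<le> (pi / (e * \<rho>))\<^sup>2" by (intro power_mono) auto
          have "norm (c k * a k ?v) = norm (c k) * (norm (dmean L (?v * cnj (\<xi> k))) * (?d k ^ 2 * ?d k ^ 2))"
            by (simp add: a_def norm_mult norm_power power_add[symmetric])
          also have "\<dots> \<le> cmax * (1 * ((pi / (e * \<rho>))\<^sup>2 * ?d k ^ 2))"
            using cmax[OF k] norm_dmean_le_1[OF vk] d cmax_pos
            by (intro mult_mono) auto
          finally show ?thesis by simp
        qed
        have "norm (poly f ?v) \<le> (\<Sum>k<T. cmax * ((pi / (e * \<rho>))\<^sup>2 * ?d k ^ 2))"
          unfolding poly_f using term_le by (intro sum_norm_le) auto
        also have "\<dots> = cmax * ((pi / (e * \<rho>))\<^sup>2 * (\<Sum>k<T. norm (dmean M (\<xi> k * cnj ?v)) ^ 2))"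
          unfolding norm_dmean_swap[of M ?v] by (simp only: sum_distrib_left)
        also have "\<dots> \<le> cmax * ((pi / (e * \<rho>))\<^sup>2 * B)"
        proof (intro mult_left_mono)
          show "(\<Sum>k<T. norm (dmean M (\<xi> k * cnj ?v)) ^ 2) \<le> B"
            unfolding B_def
          proof (rule sum_kernel_separated_le)
            fix k i assume ki: "k \<in> {..<T}" "i \<in> {..<T}" "k \<noteq> i"
            \<comment> \<open>The centres have distance at least 4 / (L + 1), which at the scale of
              the kernel \<open>dmean M\<close> is a separation with constant 2 e.\<close>
            have "2 * e * real (L + 1) \<le> 2 * e * (2 * real n)"
              using L(2) n e by (intro mult_left_mono) auto
            also have "\<dots> \<le> 4 * real (M + 1)" using M(2) by simp
            finally have "2 * e / real (M + 1) \<le> 4 / real (L + 1)"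
              by (simp add: divide_simps del: of_nat_Suc of_nat_add)
            also have "\<dots> \<le> norm (\<xi> k - \<xi> i)" using ki by (intro \<xi>_dist) auto
            finally show "2 * e / real (M + 1) \<le> norm (\<xi> k - \<xi> i)" .
          qed (use e v in \<open>auto simp: \<xi>_def\<close>)
        qed (use cmax_pos in auto)
        finally show ?thesis .
      qed
    qed
    also have "\<dots> = cmax * (C * ((pi / (e * \<rho>))\<^sup>2 * B))" by (simp only: mult_ac)
    also have "\<dots> = cmax / 2" unfolding \<rho>B by simp
    finally show False using cmax_pos l by (simp add: f_\<xi>)
  qed
  then show ?thesis using that[OF \<rho>] by blast
qed

text \<open>For d < 1 / (2 pi) choose \<open>e\<close> with (1 - 6 e) / (2 pi) above d. The boundary
  loss 2 \<rho> is negligible for large R, and R \<le> pi n holds once n is large.\<close>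

lemma MZ_imp_dense:
  assumes MZ: "MZ_family p m z" and p: "1 \<le> p"
  shows "ereal (1 / (2 * pi)) \<le> lower_density m z"
  unfolding lower_density_def le_Liminf_iff
proof (intro allI impI)
  fix y assume "y < ereal (1 / (2 * pi))"
  then obtain d where d: "y < ereal d" "d < 1 / (2 * pi)" using ereal_dense2 by force
  \<comment> \<open>The loss 6 e / (2 pi) is at most half of the gap 1 / (2 pi) - d.\<close>
  define e where "e = min (1 / 12) ((1 / (2 * pi) - d) / (12 / (2 * pi)))"
  have e: "0 < e" "e \<le> 1 / 12" using d by (auto simp: e_def)
  define g where "g = (1 - 6 * e) / (2 * pi)"
  have g: "d < g"
  proof -
    have "e \<le> (1 / (2 * pi) - d) / (12 / (2 * pi))" unfolding e_def by (rule min.cobounded2)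
    moreover have "0 < 12 / (2 * pi)" by simp
    ultimately have "e * (12 / (2 * pi)) \<le> 1 / (2 * pi) - d" by (simp only: pos_le_divide_eq)
    moreover have "e * (12 / (2 * pi)) = 2 * (6 * e / (2 * pi))" by simp
    ultimately have "2 * (6 * e / (2 * pi)) \<le> 1 / (2 * pi) - d" by linarith
    then show ?thesis using d by (simp add: g_def diff_divide_distrib)
  qed
  obtain C where "C > 0" "\<forall>n\<ge>1. \<forall>M. e * real n \<le> real (M + 1) \<longrightarrow> 2 * M \<le> n \<longrightarrow> samples n (n - 2 * M) C"
    using MZ_imp_samples[OF MZ p e(1)] by blast
  from arc_count_ge[OF e this] obtain \<rho> where \<rho>: "\<rho> > 0" and
    count: "\<And>n R x. 1 \<le> n \<Longrightarrow> 2 * \<rho> \<le> R \<Longrightarrow> R \<le> pi * real n \<Longrightarrow>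
       (R - 2 * \<rho>) * g \<le> real (card (generation m z n \<inter> open_arc x (x + R / real n)))"
    unfolding g_def by metis
  show "\<forall>\<^sub>F R in at_top. y < liminf (\<lambda>n. ereal (real (min_arc_count m z n (R / real n)) / R))"
    \<comment> \<open>The second threshold is the one at which d R \<le> (R - 2 \<rho>) g begins to
      hold.\<close>
    using eventually_ge_at_top[of "2 * \<rho>"] eventually_ge_at_top[of "2 * \<rho> * g / (g - d)"]
  proof eventually_elim
    case (elim R)
    have R: "R > 0" using elim \<rho> by linarith
    have "2 * \<rho> * g \<le> R * (g - d)" using elim g by (simp add: pos_divide_le_eq)
    then have dR: "d * R \<le> (R - 2 * \<rho>) * g" by (simp add: algebra_simps)
    obtain n0 :: nat where n0: "R / pi \<le> real n0" using real_arch_simple by blast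
    have "\<forall>\<^sub>F n in sequentially. ereal d \<le> ereal (real (min_arc_count m z n (R / real n)) / R)"
      using eventually_ge_at_top[of "n0 + 1"]
    proof eventually_elim
      case n: (elim n)
      have "R / pi \<le> real n" using n0 n by simp
      then have Rn: "R \<le> pi * real n" by (simp add: field_simps)
      obtain x where x: "min_arc_count m z n (R / real n) = card (generation m z n \<inter> open_arc x (x + R / real n))"
        by (rule min_arc_count_attained)
      have "d * R \<le> real (min_arc_count m z n (R / real n))"
        unfolding x using dR count[of n R x] n elim(1) Rn by linarith
      then show ?case using R by (simp add: pos_le_divide_eq)
    qed
    then have "ereal d \<le> liminf (\<lambda>n. ereal (real (min_arc_count m z n (R / real n)) / R))"
      by (rule Liminf_bounded)
    then show ?case using d(1) by (rule less_le_trans[rotated])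
  qed
qed

end

theorem theorem5:
  fixes m :: "nat \<Rightarrow> nat" and z :: "nat \<Rightarrow> nat \<Rightarrow> complex"
  assumes "triangular_family m z" and "separated_family m z"
  shows "(lower_density m z > ereal (1 / (2 * pi)) \<longrightarrow> (\<forall>p::ereal. 1 \<le> p \<longrightarrow> MZ_family p m z)) \<and>
         ((\<exists>p::ereal. 1 \<le> p \<and> MZ_family p m z) \<longrightarrow> lower_density m z \<ge> ereal (1 / (2 * pi)))"
proof -
  obtain \<epsilon> where \<epsilon>: "\<epsilon> > 0" and
    sep: "\<And>n j k. n \<ge> 1 \<Longrightarrow> j \<in> {0..m n} \<Longrightarrow> k \<in> {0..m n} \<Longrightarrow> j \<noteq> k \<Longrightarrow> dist (z n j) (z n k) \<ge> \<epsilon> / real n"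
    using assms(2) unfolding separated_family_def by blast
  interpret separated_points m z "min \<epsilon> 1"
  proof
    show "n \<le> m n" for n using assms(1) by (simp add: triangular_family_def)
    show "norm (z n j) = 1" if "j \<le> m n" for n j
      using assms(1) that by (auto simp: triangular_family_def)
    show "min \<epsilon> 1 / real n \<le> norm (z n j - z n k)" if "1 \<le> n" "j \<le> m n" "k \<le> m n" "j \<noteq> k" for n j k
    proof -
      have "min \<epsilon> 1 / real n \<le> \<epsilon> / real n" by (intro divide_right_mono) auto
      also have "\<dots> \<le> norm (z n j - z n k)" using sep[of n j k] that by (simp add: dist_norm)
      finally show ?thesis .
    qed
  qed (use \<epsilon> in auto)
  have "MZ_family p m z" if dense: "lower_density m z > ereal (1 / (2 * pi))" and p: "1 \<le> p" for p :: ereal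
  proof (cases "p = \<infinity>")
    case True
    then show ?thesis using dense_imp_MZ_infinity[OF dense] by (simp add: MZ_family_def)
  next
    case False
    then obtain r where r: "p = ereal r" "1 \<le> r" using p by (cases p) auto
    then show ?thesis using dense_imp_MZ_finite[OF dense r(2)] by (simp add: MZ_family_def)
  qed
  then show ?thesis using MZ_imp_dense by blast
qed

end
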